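(* Consider the integro-differential equation $$F(x,u,\nabla u,\nabla^2 u)-\int_{\mathbf{R}^N}\bigl[u(x+z)-u(x)-\mathbf 1_{|z|\le 1}\langle \nabla u(x),z\rangle\bigr]q(z)\,dz=0,\qquad x\in\Omega, \qquad (E)$$ with $\Omega$, $F$, $q$ as specified in the context. Then Definitions A, B and C (given in the context) of viscosity subsolutions, supersolutions and solutions of (E) are equivalent.
   Context: Setting: $\Omega\subset\mathbf{R}^N$; $\mathbf{S}^N$ is the space of real symmetric $N\times N$ matrices; $F\in C(\Omega\times\mathbf{R}\times\mathbf{R}^N\times\mathbf{S}^N)$ is a second-order fully nonlinear elliptic operator (ellipticity in the usual sense of viscosity solution theory: $F(x,r,p,X)\ge F(x,r,p,Y)$ whenever $X\le Y$). The Lévy measure $q(z)\,dz$ is a positive Radon measure with $\int_{|z|<1}|z|^2q(z)\,dz+\int_{|z|\ge 1}q(z)\,dz<\infty$. $\mathbf 1_{|z|\le 1}$ is the indicator function of $\{|z|\le 1\}$, and $I$ is the identity matrix. $USC(\mathbf{R}^N)$ and $LSC(\mathbf{R}^N)$ denote the upper and lower semicontinuous functions on $\mathbf{R}^N$. For $u\in USC(\mathbf{R}^N)$, $J^{2,+}_{\mathbf{R}^N}u(x)$ is the set of $(p,X)\in\mathbf{R}^N\times\mathbf{S}^N$ such that for any $\delta>0$ there exists $\varepsilon>0$ with $$u(x+z)-u(x)\le\langle p,z\rangle+\tfrac12\langle Xz,z\rangle+\delta|z|^2\quad\forall |z|\le\varepsilon. \qquad (1)$$ For $v\in LSC(\mathbf{R}^N)$,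 $J^{2,-}_{\mathbf{R}^N}v(x)$ is the set of $(p,X)\in\mathbf{R}^N\times\mathbf{S}^N$ such that for any $\delta>0$ there exists $\varepsilon>0$ with $$v(x+z)-v(x)\ge\langle p,z\rangle+\tfrac12\langle Xz,z\rangle-\delta|z|^2\quad\forall |z|\le\varepsilon. \qquad (2)$$ Definition A. $u\in USC(\mathbf{R}^N)$ (resp. $v\in LSC(\mathbf{R}^N)$) is a viscosity subsolution (resp. supersolution) of (E) if for any $\hat x\in\Omega$, any $(p,X)\in J^{2,+}_{\mathbf{R}^N}u(\hat x)$ (resp. $\in J^{2,-}_{\mathbf{R}^N}v(\hat x)$), and any pair of positive numbers $(\varepsilon,\delta)$ satisfying (1) (resp. (2)) at $x=\hat x$, $$F(\hat x,u(\hat x),p,X)-\int_{|z|<\varepsilon}\tfrac12\langle(X+2\delta I)z,z\rangle q(z)\,dz-\int_{|z|\ge\varepsilon}[u(\hat x+z)-u(\hat x)-\mathbf 1_{|z|\le1}\langle z,p\rangle]q(z)\,dz\le0$$ (resp. $$F(\hat x,v(\hat x),p,X)-\int_{|z|<\varepsilon}\tfrac12\langle(X-2\delta I)z,z\rangle q(z)\,dz-\int_{|z|\ge\varepsilon}[v(\hat x+z)-v(\hat x)-\mathbf 1_{|z|\le1}\langle z,p\rangle]q(z)\,dz\ge0).$$ Definition B. $u\in USC(\mathbf{R}^N)$ (resp. $v\in LSC(\mathbf{R}^N)$) is a viscosity subsolution (resp. supersolution) of (E) if for any $\hat x\in\Omega$ and any $\phi\in C^2(\mathbf{R}^N)$ such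 that $u(\hat x)=\phi(\hat x)$ and $u-\phi$ takes a global maximum at $\hat x$ (resp. $v(\hat x)=\phi(\hat x)$ and $v-\phi$ takes a global minimum at $\hat x$), $$F(\hat x,u(\hat x),\nabla\phi(\hat x),\nabla^2\phi(\hat x))-\int_{\mathbf{R}^N}[\phi(\hat x+z)-\phi(\hat x)-\mathbf 1_{|z|\le1}\langle z,\nabla\phi(\hat x)\rangle]q(z)\,dz\le 0$$ (resp. $$F(\hat x,v(\hat x),\nabla\phi(\hat x),\nabla^2\phi(\hat x))-\int_{\mathbf{R}^N}[\phi(\hat x+z)-\phi(\hat x)-\mathbf 1_{|z|\le1}\langle z,\nabla\phi(\hat x)\rangle]q(z)\,dz\ge 0).$$ Definition C. $u\in USC(\mathbf{R}^N)$ (resp. $v\in LSC(\mathbf{R}^N)$) is a viscosity subsolution (resp. supersolution) of (E) if for any $\hat x\in\Omega$ and any $\phi\in C^2(\mathbf{R}^N)$ such that $u(\hat x)=\phi(\hat x)$ and $u-\phi$ takes a global maximum at $\hat x$ (resp. $v(\hat x)=\phi(\hat x)$ and $v-\phi$ takes a global minimum at $\hat x$), the function $h(z)=u(\hat x+z)-u(\hat x)-\mathbf 1_{|z|\le1}\langle z,\nabla\phi(\hat x)\rangle$ (resp. the same with $v$ in place of $u$) belongs to $L^1(\mathbf{R}^N,q(z)dz)$ and $$F(\hat x,u(\hat x),\nabla\phi(\hat x),\nabla^2\phi(\hat x))-\int_{\mathbf{R}^N}[u(\hat x+z)-u(\hat x)-\mathbf 1_{|z|\le1}\langle z,\nabla\phi(\hat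 x)\rangle]q(z)\,dz\le 0$$ (resp. $$F(\hat x,v(\hat x),\nabla\phi(\hat x),\nabla^2\phi(\hat x))-\int_{\mathbf{R}^N}[v(\hat x+z)-v(\hat x)-\mathbf 1_{|z|\le1}\langle z,\nabla\phi(\hat x)\rangle]q(z)\,dz\ge 0).$$ In each of the three definitions, $u$ is a viscosity solution if it is both a viscosity subsolution and a viscosity supersolution.
   Formalization: Definition A is required only for ε ≤ 1 (for larger ε it fails for asymmetric q), and u⁺(x+·) for subsolutions, v⁻(x+·) for supersolutions, both for solutions, are assumed q-integrable on |z|≥1 for x in Ω; divergent integrals in A, B are taken in [-∞,∞]. *)

theory Defs
  imports "HOL-Analysis.Analysis"
begin

definition usc :: "(real^'n \<Rightarrow> real) \<Rightarrow> bool" where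
  "usc u \<longleftrightarrow> (\<forall>a. open {x. u x < a})"

definition lsc :: "(real^'n \<Rightarrow> real) \<Rightarrow> bool" where
  "lsc v \<longleftrightarrow> (\<forall>a. open {x. a < v x})"

definition sym_matrices :: "(real^'n^'n) set" where
  "sym_matrices = {X. transpose X = X}"

definition quad :: "real^'n^'n \<Rightarrow> real^'n \<Rightarrow> real" where
  "quad X z = (X *v z) \<bullet> z"

definition matrix_le :: "real^'n^'n \<Rightarrow> real^'n^'n \<Rightarrow> bool" where
  "matrix_le X Y \<longleftrightarrow> (\<forall>z. quad X z \<le> quad Y z)"

definition elliptic ::
  "(real^'n) set \<Rightarrow> (real^'n \<Rightarrow> real \<Rightarrow> real^'n \<Rightarrow> real^'n^'n \<Rightarrow> real) \<Rightarrow> bool" where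
  "elliptic \<Omega> F \<longleftrightarrow>
     (\<forall>x\<in>\<Omega>. \<forall>r p. \<forall>X\<in>sym_matrices. \<forall>Y\<in>sym_matrices. matrix_le X Y \<longrightarrow> F x r p X \<ge> F x r p Y)"

definition continuous_operator ::
  "(real^'n) set \<Rightarrow> (real^'n \<Rightarrow> real \<Rightarrow> real^'n \<Rightarrow> real^'n^'n \<Rightarrow> real) \<Rightarrow> bool" where
  "continuous_operator \<Omega> F \<longleftrightarrow>
     continuous_on (\<Omega> \<times> UNIV \<times> UNIV \<times> sym_matrices) (\<lambda>(x, r, p, X). F x r p X)"

text \<open>The measure \<open>q(z) dz\<close> is kept as a measure, so absolute continuity is not required; the case of
  a density is \<open>density lborel q\<close>. Away from the origin the integrability condition implies local
  finiteness, hence the Radon property. The mass of the origin is irrelevant, since all integrands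
  below vanish there.\<close>

definition levy_measure :: "(real^'n) measure \<Rightarrow> bool" where
  "levy_measure q \<longleftrightarrow> sets q = sets borel \<and>
     (\<integral>\<^sup>+z\<in>{z. norm z < 1}. ennreal ((norm z)\<^sup>2) \<partial>q) + emeasure q {z. 1 \<le> norm z} < \<infinity>"

text \<open>The Lebesgue integral with values in \<open>[-\<infinity>, \<infinity>]\<close>. The function \<open>ennreal\<close> sends negative numbers
  to 0, so the two terms are the integrals of the positive and of the negative part.\<close>

definition ext_integral :: "'a measure \<Rightarrow> ('a \<Rightarrow> real) \<Rightarrow> ereal" where
  "ext_integral M f =
     enn2ereal (\<integral>\<^sup>+z. ennreal (f z) \<partial>M) - enn2ereal (\<integral>\<^sup>+z. ennreal (- f z) \<partial>M)"

definition has_ext_integral :: "'a measure \<Rightarrow> ('a \<Rightarrow> real) \<Rightarrow> bool" where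
  "has_ext_integral M f \<longleftrightarrow>
     (\<integral>\<^sup>+z. ennreal (f z) \<partial>M) < \<infinity> \<or> (\<integral>\<^sup>+z. ennreal (- f z) \<partial>M) < \<infinity>"

definition levy_increment :: "(real^'n \<Rightarrow> real) \<Rightarrow> real^'n \<Rightarrow> real^'n \<Rightarrow> real^'n \<Rightarrow> real" where
  "levy_increment u x p z = u (x + z) - u x - indicator {z. norm z \<le> 1} z * (z \<bullet> p)"

text \<open>The conditions on \<open>u\<close> and \<open>v\<close> at infinity under which the integral of the Levy increment over
  \<open>\<bar>z\<bar> \<ge> \<epsilon>\<close> is well defined in \<open>[-\<infinity>, \<infinity>)\<close> for a usc \<open>u\<close> and in \<open>(-\<infinity>, \<infinity>]\<close> for an lsc \<open>v\<close>.
  Functions bounded above, respectively below, satisfy them.\<close>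

definition tail_above ::
  "(real^'n) measure \<Rightarrow> (real^'n) set \<Rightarrow> (real^'n \<Rightarrow> real) \<Rightarrow> bool" where
  "tail_above q \<Omega> u \<longleftrightarrow>
     (\<forall>x\<in>\<Omega>. (\<integral>\<^sup>+z\<in>{z. 1 \<le> norm z}. ennreal (u (x + z)) \<partial>q) < \<infinity>)"

definition tail_below ::
  "(real^'n) measure \<Rightarrow> (real^'n) set \<Rightarrow> (real^'n \<Rightarrow> real) \<Rightarrow> bool" where
  "tail_below q \<Omega> v \<longleftrightarrow>
     (\<forall>x\<in>\<Omega>. (\<integral>\<^sup>+z\<in>{z. 1 \<le> norm z}. ennreal (- v (x + z)) \<partial>q) < \<infinity>)"

definition grad :: "(real^'n \<Rightarrow> real) \<Rightarrow> real^'n \<Rightarrow> real^'n" where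
  "grad \<phi> x = (THE g. GDERIV \<phi> x :> g)"

definition hess :: "(real^'n \<Rightarrow> real) \<Rightarrow> real^'n \<Rightarrow> real^'n^'n" where
  "hess \<phi> x = jacobian (grad \<phi>) (at x)"

definition C2 :: "(real^'n \<Rightarrow> real) \<Rightarrow> bool" where
  "C2 \<phi> \<longleftrightarrow> (\<forall>x. \<phi> differentiable (at x)) \<and> (\<forall>x. grad \<phi> differentiable (at x)) \<and>
     continuous_on UNIV (hess \<phi>)"

definition upper_expansion ::
  "(real^'n \<Rightarrow> real) \<Rightarrow> real^'n \<Rightarrow> real^'n \<Rightarrow> real^'n^'n \<Rightarrow> real \<Rightarrow> real \<Rightarrow> bool" where
  "upper_expansion u x p X \<epsilon> \<delta> \<longleftrightarrow>
     (\<forall>z. norm z \<le> \<epsilon> \<longrightarrow> u (x + z) - u x \<le> p \<bullet> z + 1/2 * quad X z + \<delta> * (norm z)\<^sup>2)"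

definition lower_expansion ::
  "(real^'n \<Rightarrow> real) \<Rightarrow> real^'n \<Rightarrow> real^'n \<Rightarrow> real^'n^'n \<Rightarrow> real \<Rightarrow> real \<Rightarrow> bool" where
  "lower_expansion v x p X \<epsilon> \<delta> \<longleftrightarrow>
     (\<forall>z. norm z \<le> \<epsilon> \<longrightarrow> v (x + z) - v x \<ge> p \<bullet> z + 1/2 * quad X z - \<delta> * (norm z)\<^sup>2)"

definition J2_plus :: "(real^'n \<Rightarrow> real) \<Rightarrow> real^'n \<Rightarrow> ((real^'n) \<times> (real^'n^'n)) set" where
  "J2_plus u x =
     {(p, X). X \<in> sym_matrices \<and> (\<forall>\<delta>>0. \<exists>\<epsilon>>0. upper_expansion u x p X \<epsilon> \<delta>)}"

definition J2_minus :: "(real^'n \<Rightarrow> real) \<Rightarrow> real^'n \<Rightarrow> ((real^'n) \<times> (real^'n^'n)) set" where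
  "J2_minus v x =
     {(p, X). X \<in> sym_matrices \<and> (\<forall>\<delta>>0. \<exists>\<epsilon>>0. lower_expansion v x p X \<epsilon> \<delta>)}"

definition touches_above :: "(real^'n \<Rightarrow> real) \<Rightarrow> (real^'n \<Rightarrow> real) \<Rightarrow> real^'n \<Rightarrow> bool" where
  "touches_above \<phi> u x \<longleftrightarrow> u x = \<phi> x \<and> (\<forall>y. u y - \<phi> y \<le> u x - \<phi> x)"

definition touches_below :: "(real^'n \<Rightarrow> real) \<Rightarrow> (real^'n \<Rightarrow> real) \<Rightarrow> real^'n \<Rightarrow> bool" where
  "touches_below \<phi> v x \<longleftrightarrow> v x = \<phi> x \<and> (\<forall>y. v x - \<phi> x \<le> v y - \<phi> y)"

text \<open>The integrand of \<open>subsolution_A\<close> over \<open>\<bar>z\<bar> < \<epsilon>\<close> carries no first-order term, which is consistent with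
  the truncation \<open>\<bar>z\<bar> \<le> 1\<close> of the gradient term only if \<open>\<epsilon> \<le> 1\<close>: for larger \<open>\<epsilon>\<close> and asymmetric
  \<open>q\<close> the integral of \<open>\<langle>p, z\<rangle>\<close> over \<open>1 < \<bar>z\<bar> < \<epsilon>\<close> would be lost. Hence the bound on \<open>\<epsilon>\<close>.\<close>

definition subsolution_A ::
  "(real^'n) set \<Rightarrow> (real^'n \<Rightarrow> real \<Rightarrow> real^'n \<Rightarrow> real^'n^'n \<Rightarrow> real) \<Rightarrow> (real^'n) measure \<Rightarrow>
   (real^'n \<Rightarrow> real) \<Rightarrow> bool" where
  "subsolution_A \<Omega> F q u \<longleftrightarrow> usc u \<and>
     (\<forall>x\<in>\<Omega>. \<forall>(p, X)\<in>J2_plus u x. \<forall>\<epsilon> \<delta>.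
        0 < \<epsilon> \<and> \<epsilon> \<le> 1 \<and> 0 < \<delta> \<and> upper_expansion u x p X \<epsilon> \<delta> \<longrightarrow>
        ereal (F x (u x) p X)
        - ereal (LINT z:{z. norm z < \<epsilon>}|q. 1/2 * quad (X + (2 * \<delta>) *\<^sub>R mat 1) z)
        - ext_integral q (\<lambda>z. indicator {z. \<epsilon> \<le> norm z} z * levy_increment u x p z) \<le> 0)"

definition supersolution_A ::
  "(real^'n) set \<Rightarrow> (real^'n \<Rightarrow> real \<Rightarrow> real^'n \<Rightarrow> real^'n^'n \<Rightarrow> real) \<Rightarrow> (real^'n) measure \<Rightarrow>
   (real^'n \<Rightarrow> real) \<Rightarrow> bool" where
  "supersolution_A \<Omega> F q v \<longleftrightarrow> lsc v \<and>
     (\<forall>x\<in>\<Omega>. \<forall>(p, X)\<in>J2_minus v x. \<forall>\<epsilon> \<delta>.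
        0 < \<epsilon> \<and> \<epsilon> \<le> 1 \<and> 0 < \<delta> \<and> lower_expansion v x p X \<epsilon> \<delta> \<longrightarrow>
        ereal (F x (v x) p X)
        - ereal (LINT z:{z. norm z < \<epsilon>}|q. 1/2 * quad (X - (2 * \<delta>) *\<^sub>R mat 1) z)
        - ext_integral q (\<lambda>z. indicator {z. \<epsilon> \<le> norm z} z * levy_increment v x p z) \<ge> 0)"

text \<open>In \<open>subsolution_B\<close> a \<open>C\<^sup>2\<close> test function may grow arbitrarily fast, so its integral is taken in
  \<open>[-\<infinity>, \<infinity>]\<close>; a test function imposes no condition when the positive and the negative part both have
  infinite integral.\<close>

definition subsolution_B ::
  "(real^'n) set \<Rightarrow> (real^'n \<Rightarrow> real \<Rightarrow> real^'n \<Rightarrow> real^'n^'n \<Rightarrow> real) \<Rightarrow> (real^'n) measure \<Rightarrow>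
   (real^'n \<Rightarrow> real) \<Rightarrow> bool" where
  "subsolution_B \<Omega> F q u \<longleftrightarrow> usc u \<and>
     (\<forall>x\<in>\<Omega>. \<forall>\<phi>. C2 \<phi> \<and> touches_above \<phi> u x \<and>
        has_ext_integral q (levy_increment \<phi> x (grad \<phi> x)) \<longrightarrow>
        ereal (F x (u x) (grad \<phi> x) (hess \<phi> x))
        - ext_integral q (levy_increment \<phi> x (grad \<phi> x)) \<le> 0)"

definition supersolution_B ::
  "(real^'n) set \<Rightarrow> (real^'n \<Rightarrow> real \<Rightarrow> real^'n \<Rightarrow> real^'n^'n \<Rightarrow> real) \<Rightarrow> (real^'n) measure \<Rightarrow>
   (real^'n \<Rightarrow> real) \<Rightarrow> bool" where
  "supersolution_B \<Omega> F q v \<longleftrightarrow> lsc v \<and>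
     (\<forall>x\<in>\<Omega>. \<forall>\<phi>. C2 \<phi> \<and> touches_below \<phi> v x \<and>
        has_ext_integral q (levy_increment \<phi> x (grad \<phi> x)) \<longrightarrow>
        ereal (F x (v x) (grad \<phi> x) (hess \<phi> x))
        - ext_integral q (levy_increment \<phi> x (grad \<phi> x)) \<ge> 0)"

definition subsolution_C ::
  "(real^'n) set \<Rightarrow> (real^'n \<Rightarrow> real \<Rightarrow> real^'n \<Rightarrow> real^'n^'n \<Rightarrow> real) \<Rightarrow> (real^'n) measure \<Rightarrow>
   (real^'n \<Rightarrow> real) \<Rightarrow> bool" where
  "subsolution_C \<Omega> F q u \<longleftrightarrow> usc u \<and>
     (\<forall>x\<in>\<Omega>. \<forall>\<phi>. C2 \<phi> \<and> touches_above \<phi> u x \<longrightarrow>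
        integrable q (levy_increment u x (grad \<phi> x)) \<and>
        F x (u x) (grad \<phi> x) (hess \<phi> x) - (LINT z|q. levy_increment u x (grad \<phi> x) z) \<le> 0)"

definition supersolution_C ::
  "(real^'n) set \<Rightarrow> (real^'n \<Rightarrow> real \<Rightarrow> real^'n \<Rightarrow> real^'n^'n \<Rightarrow> real) \<Rightarrow> (real^'n) measure \<Rightarrow>
   (real^'n \<Rightarrow> real) \<Rightarrow> bool" where
  "supersolution_C \<Omega> F q v \<longleftrightarrow> lsc v \<and>
     (\<forall>x\<in>\<Omega>. \<forall>\<phi>. C2 \<phi> \<and> touches_below \<phi> v x \<longrightarrow>
        integrable q (levy_increment v x (grad \<phi> x)) \<and>
        F x (v x) (grad \<phi> x) (hess \<phi> x) - (LINT z|q. levy_increment v x (grad \<phi> x) z) \<ge> 0)"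

definition solution_A ::
  "(real^'n) set \<Rightarrow> (real^'n \<Rightarrow> real \<Rightarrow> real^'n \<Rightarrow> real^'n^'n \<Rightarrow> real) \<Rightarrow> (real^'n) measure \<Rightarrow>
   (real^'n \<Rightarrow> real) \<Rightarrow> bool" where
  "solution_A \<Omega> F q u \<longleftrightarrow> subsolution_A \<Omega> F q u \<and> supersolution_A \<Omega> F q u"

definition solution_B ::
  "(real^'n) set \<Rightarrow> (real^'n \<Rightarrow> real \<Rightarrow> real^'n \<Rightarrow> real^'n^'n \<Rightarrow> real) \<Rightarrow> (real^'n) measure \<Rightarrow>
   (real^'n \<Rightarrow> real) \<Rightarrow> bool" where
  "solution_B \<Omega> F q u \<longleftrightarrow> subsolution_B \<Omega> F q u \<and> supersolution_B \<Omega> F q u"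

definition solution_C ::
  "(real^'n) set \<Rightarrow> (real^'n \<Rightarrow> real \<Rightarrow> real^'n \<Rightarrow> real^'n^'n \<Rightarrow> real) \<Rightarrow> (real^'n) measure \<Rightarrow>
   (real^'n \<Rightarrow> real) \<Rightarrow> bool" where
  "solution_C \<Omega> F q u \<longleftrightarrow> subsolution_C \<Omega> F q u \<and> supersolution_C \<Omega> F q u"

end

theory Submission
  imports Defs
begin

text \<open>All three definitions of a subsolution are shown to be equivalent to a fourth one, called
  \<open>subsolution_J\<close> below: for every \<open>x \<in> \<Omega>\<close> and every \<open>(p, X)\<close> in the second-order superjet of \<open>u\<close> at \<open>x\<close>,
  the Levy increment of \<open>u\<close> with gradient \<open>p\<close> is integrable and \<open>F x (u x) p X\<close> is at most its integral.

  The superjet inequality bounds the increment from above by a function that is integrable with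
  respect to the Levy measure: it is quadratic near the origin, and away from it the bound follows
  from semicontinuity and the condition on \<open>u\<close> at infinity (\<open>integrable_dominant\<close>,
  \<open>levy_increment_le_dominant\<close>). The reverse Fatou lemma (\<open>reverse_Fatou\<close>) therefore passes an
  inequality to the limit and yields integrability of the limit at the same time. It is used twice.

  From A to J, the quadratic function on the ball of radius \<open>\<epsilon>\<close> is replaced by the increment of \<open>u\<close> as \<open>\<epsilon>\<close>
  tends to \<open>0\<close>. The converse is monotonicity of the integral. J implies C because a test function
  touching from above has its gradient and Hessian in the superjet (\<open>touches_above_imp_superjet\<close>, by
  Taylor expansion and symmetry of the Hessian), and C implies B because the increment of the test
  function dominates that of \<open>u\<close>.

  From B to J, test functions are needed whose increments converge to that of \<open>u\<close>
  (\<open>test_function\<close>). Near \<open>x\<close> such a function is the quadratic function with Hessian \<open>X + 2\<eta>I\<close>, which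
  lies above \<open>u\<close> on a small ball. On shells around \<open>x\<close> it is a polynomial above \<open>max u (-M)\<close> that
  is close to it in \<open>L\<^sup>1\<close> (\<open>usc_polynomial_majorant\<close>), and the pieces are glued by a radial partition of
  unity of class \<open>C\<^sup>2\<close>. Continuity of \<open>F\<close> in the matrix variable removes \<open>\<eta>\<close> in the limit.

  Supersolutions are reduced to subsolutions: \<open>v\<close> is replaced by \<open>-v\<close> and \<open>F x r p X\<close> by
  \<open>- F x (- r) (- p) (- X)\<close>.\<close>

section \<open>Functions of class \<open>C\<^sup>2\<close> on an open set\<close>

text \<open>Functions with a gradient and a continuous second derivative on an open set. The second
  derivative is recorded as a linear map for each point rather than as a matrix, so that the product
  and chain rules involve no outer products; its continuity is required pointwise in the direction,
  which suffices in finite dimension.\<close>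

definition C2_on :: "(real^'n) set \<Rightarrow> (real^'n \<Rightarrow> real) \<Rightarrow> bool" where
  "C2_on S f \<longleftrightarrow> open S \<and> (\<exists>g D. (\<forall>y\<in>S. GDERIV f y :> g y \<and> (g has_derivative D y) (at y)) \<and>
     (\<forall>h. continuous_on S (\<lambda>y. D y h)))"

lemma C2_onI:
  assumes "open S" "\<And>y. y \<in> S \<Longrightarrow> GDERIV f y :> g y"
    "\<And>y. y \<in> S \<Longrightarrow> (g has_derivative D y) (at y)" "\<And>h. continuous_on S (\<lambda>y. D y h)"
  shows "C2_on S f"
  using assms unfolding C2_on_def by blast

lemma C2_onE:
  assumes "C2_on S f"
  obtains g D where "open S" "\<And>y. y \<in> S \<Longrightarrow> GDERIV f y :> g y"
    "\<And>y. y \<in> S \<Longrightarrow> (g has_derivative D y) (at y)" "\<And>h. continuous_on S (\<lambda>y. D y h)"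
  using assms unfolding C2_on_def by blast

lemma GDERIV_unique:
  fixes f :: "'a::real_inner \<Rightarrow> real"
  assumes "GDERIV f x :> a" "GDERIV f x :> b"
  shows "a = b"
proof -
  have "(\<lambda>h. inner h a) = (\<lambda>h. inner h b)"
    using assms unfolding gderiv_def by (rule has_derivative_unique)
  then show ?thesis
    by (metis vector_eq_ldot)
qed

lemma grad_eq: "GDERIV f x :> g \<Longrightarrow> grad f x = g"
  unfolding grad_def by (blast intro: the_equality GDERIV_unique)

lemma hess_eq:
  assumes "(grad f has_derivative D) (at x)"
  shows "hess f x = matrix D"
  using frechet_derivative_at[OF assms] by (simp add: hess_def jacobian_def)

lemma GDERIV_grad:
  assumes "f differentiable (at x)"
  shows "GDERIV f x :> grad f x"
proof -
  obtain D where D: "(f has_derivative D) (at x)"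
    using assms by (auto simp: differentiable_def)
  then have "linear D" by (rule has_derivative_linear)
  then have "D = (\<lambda>h. h \<bullet> adjoint D 1)"
    by (simp add: adjoint_works)
  with D have "GDERIV f x :> adjoint D 1"
    by (simp add: gderiv_def)
  then show ?thesis by (simp add: grad_eq)
qed

lemma C2_grad: "C2 f \<Longrightarrow> GDERIV f x :> grad f x"
  by (simp add: C2_def GDERIV_grad)

lemma C2_hess: "C2 f \<Longrightarrow> (grad f has_derivative (*v) (hess f x)) (at x)"
  unfolding C2_def hess_def by (metis jacobian_works)

lemma GDERIV_transform_within_open:
  assumes "GDERIV f x :> a" "open S" "x \<in> S" "\<And>y. y \<in> S \<Longrightarrow> f y = h y"
  shows "GDERIV h x :> a"
  using assms unfolding gderiv_def by (metis has_derivative_transform_within_open)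

lemma C2_on_cong:
  assumes "C2_on S f" "\<And>y. y \<in> S \<Longrightarrow> f y = h y"
  shows "C2_on S h"
proof -
  obtain g D where *: "open S" "\<And>y. y \<in> S \<Longrightarrow> GDERIV f y :> g y"
    "\<And>y. y \<in> S \<Longrightarrow> (g has_derivative D y) (at y)" "\<And>h. continuous_on S (\<lambda>y. D y h)"
    using assms(1) by (rule C2_onE) (rule that, assumption+)
  have "\<And>y. y \<in> S \<Longrightarrow> GDERIV h y :> g y"
    using GDERIV_transform_within_open[OF *(2) *(1)] assms(2) by blast
  with * show ?thesis by (intro C2_onI[of S h g D]) auto
qed

lemma has_derivative_grad_on:
  assumes "open S" "\<And>y. y \<in> S \<Longrightarrow> GDERIV f y :> g y" "(g has_derivative D) (at x)" "x \<in> S"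
  shows "(grad f has_derivative D) (at x)"
  by (rule has_derivative_transform_within_open[OF assms(3,1,4)]) (use assms(2) grad_eq in metis)

text \<open>Being of class \<open>C\<^sup>2\<close> is a local property.\<close>

lemma C2_locally:
  assumes "\<And>x. \<exists>S. x \<in> S \<and> C2_on S f"
  shows "C2 f"
proof -
  have main: "f differentiable (at x) \<and> grad f differentiable (at x) \<and> isCont (hess f) x" for x
  proof -
    obtain S where S: "x \<in> S" "C2_on S f" using assms by blast
    obtain g D where *: "open S" "\<And>y. y \<in> S \<Longrightarrow> GDERIV f y :> g y"
      "\<And>y. y \<in> S \<Longrightarrow> (g has_derivative D y) (at y)" "\<And>h. continuous_on S (\<lambda>y. D y h)"
      using S(2) by (rule C2_onE) (rule that, assumption+)
    have D: "(grad f has_derivative D y) (at y)" if "y \<in> S" for y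
      using has_derivative_grad_on[OF *(1,2) *(3)] that by blast
    have "continuous_on S (\<lambda>y. \<chi> i j. D y (axis j 1) $ i)"
      by (intro continuous_intros *(4))
    then have "continuous_on S (hess f)"
      by (subst continuous_on_cong[OF refl]) (auto simp: hess_eq[OF D] matrix_def)
    then have "isCont (hess f) x"
      using *(1) S(1) by (simp add: continuous_on_eq_continuous_at)
    with *(2) D S(1) show ?thesis
      unfolding gderiv_def differentiable_def by blast
  qed
  then show ?thesis
    by (auto simp: C2_def continuous_at_imp_continuous_on)
qed

lemma C2_on_const: "open S \<Longrightarrow> C2_on S (\<lambda>y. c)"
  by (rule C2_onI[where g = "\<lambda>_. 0" and D = "\<lambda>_ _. 0"]) (auto simp: GDERIV_const)

lemma C2_on_linear:
  assumes "bounded_linear f" "open S" shows "C2_on S f"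
proof (rule C2_onI[where g = "\<lambda>_. adjoint f 1" and D = "\<lambda>_ _. 0"])
  have "f = (\<lambda>h. h \<bullet> adjoint f 1)"
    using assms by (simp add: adjoint_works bounded_linear.linear)
  then show "GDERIV f y :> adjoint f 1" for y
    using bounded_linear_imp_has_derivative[OF assms(1)] by (simp add: gderiv_def)
qed (use assms in auto)

lemma C2_on_add:
  assumes "C2_on S f1" "C2_on S f2" shows "C2_on S (\<lambda>y. f1 y + f2 y)"
proof -
  obtain g1 D1 where 1: "open S" "\<And>y. y \<in> S \<Longrightarrow> GDERIV f1 y :> g1 y"
    "\<And>y. y \<in> S \<Longrightarrow> (g1 has_derivative D1 y) (at y)" "\<And>h. continuous_on S (\<lambda>y. D1 y h)"
    using assms(1) by (rule C2_onE) (rule that, assumption+)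
  obtain g2 D2 where 2: "open S" "\<And>y. y \<in> S \<Longrightarrow> GDERIV f2 y :> g2 y"
    "\<And>y. y \<in> S \<Longrightarrow> (g2 has_derivative D2 y) (at y)" "\<And>h. continuous_on S (\<lambda>y. D2 y h)"
    using assms(2) by (rule C2_onE) (rule that, assumption+)
  show ?thesis
    by (rule C2_onI[where g = "\<lambda>y. g1 y + g2 y" and D = "\<lambda>y h. D1 y h + D2 y h"])
      (use 1 2 in \<open>auto intro!: GDERIV_add has_derivative_add continuous_on_add\<close>)
qed

lemma C2_on_mult:
  assumes "C2_on S f1" "C2_on S f2" shows "C2_on S (\<lambda>y. f1 y * f2 y)"
proof -
  obtain g1 D1 where 1: "open S" "\<And>y. y \<in> S \<Longrightarrow> GDERIV f1 y :> g1 y"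
    "\<And>y. y \<in> S \<Longrightarrow> (g1 has_derivative D1 y) (at y)" "\<And>h. continuous_on S (\<lambda>y. D1 y h)"
    using assms(1) by (rule C2_onE) (rule that, assumption+)
  obtain g2 D2 where 2: "open S" "\<And>y. y \<in> S \<Longrightarrow> GDERIV f2 y :> g2 y"
    "\<And>y. y \<in> S \<Longrightarrow> (g2 has_derivative D2 y) (at y)" "\<And>h. continuous_on S (\<lambda>y. D2 y h)"
    using assms(2) by (rule C2_onE) (rule that, assumption+)
  have cont: "continuous_on S f1" "continuous_on S f2" "continuous_on S g1" "continuous_on S g2"
    using 1 2 unfolding gderiv_def
    by (meson continuous_at_imp_continuous_on has_derivative_continuous)+
  show ?thesis
  proof (rule C2_onI[where g = "\<lambda>y. f1 y *\<^sub>R g2 y + f2 y *\<^sub>R g1 y" and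
          D = "\<lambda>y h. (f1 y *\<^sub>R D2 y h + (h \<bullet> g1 y) *\<^sub>R g2 y) + (f2 y *\<^sub>R D1 y h + (h \<bullet> g2 y) *\<^sub>R g1 y)"])
    show "((\<lambda>y. f1 y *\<^sub>R g2 y + f2 y *\<^sub>R g1 y) has_derivative
        (\<lambda>h. (f1 y *\<^sub>R D2 y h + (h \<bullet> g1 y) *\<^sub>R g2 y) + (f2 y *\<^sub>R D1 y h + (h \<bullet> g2 y) *\<^sub>R g1 y))) (at y)"
      if "y \<in> S" for y
      using 1(2,3)[OF that] 2(2,3)[OF that] unfolding gderiv_def
      by (intro has_derivative_add has_derivative_scaleR) auto
  qed (use 1 2 cont in \<open>auto intro!: GDERIV_mult continuous_intros\<close>)
qed

lemma C2_on_compose: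
  fixes k k' k'' :: "real \<Rightarrow> real"
  assumes "C2_on S f" "\<And>t. (k has_real_derivative k' t) (at t)"
    "\<And>t. (k' has_real_derivative k'' t) (at t)" "continuous_on UNIV k''"
  shows "C2_on S (\<lambda>y. k (f y))"
proof -
  obtain g D where 1: "open S" "\<And>y. y \<in> S \<Longrightarrow> GDERIV f y :> g y"
    "\<And>y. y \<in> S \<Longrightarrow> (g has_derivative D y) (at y)" "\<And>h. continuous_on S (\<lambda>y. D y h)"
    using assms(1) by (rule C2_onE) (rule that, assumption+)
  have cont: "continuous_on S f" "continuous_on S g"
    using 1 unfolding gderiv_def
    by (meson continuous_at_imp_continuous_on has_derivative_continuous)+
  have k': "continuous_on UNIV k'"
    using assms(3) by (meson DERIV_isCont continuous_at_imp_continuous_on)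
  have kc: "continuous_on S (\<lambda>y. k' (f y))" "continuous_on S (\<lambda>y. k'' (f y))"
    using continuous_on_compose2[OF k' cont(1)] continuous_on_compose2[OF assms(4) cont(1)] by auto
  show ?thesis
  proof (rule C2_onI[where g = "\<lambda>y. k' (f y) *\<^sub>R g y" and
          D = "\<lambda>y h. k' (f y) *\<^sub>R D y h + (k'' (f y) * (h \<bullet> g y)) *\<^sub>R g y"])
    show "GDERIV (\<lambda>y. k (f y)) y :> k' (f y) *\<^sub>R g y" if "y \<in> S" for y
      using GDERIV_DERIV_compose[OF 1(2)[OF that] assms(2)] .
    show "((\<lambda>y. k' (f y) *\<^sub>R g y) has_derivative
        (\<lambda>h. k' (f y) *\<^sub>R D y h + (k'' (f y) * (h \<bullet> g y)) *\<^sub>R g y)) (at y)" if "y \<in> S" for y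
      using GDERIV_DERIV_compose[OF 1(2)[OF that] assms(3)] 1(3)[OF that]
      unfolding gderiv_def by (intro has_derivative_scaleR) (auto simp: mult.commute)
  qed (use 1 cont kc in \<open>auto intro!: continuous_intros\<close>)
qed

lemma C2_on_translate:
  fixes a :: "real^'n"
  assumes "C2_on S f" shows "C2_on ((+) a ` S) (\<lambda>y. f (y - a))"
proof -
  obtain g D where 1: "open S" "\<And>y. y \<in> S \<Longrightarrow> GDERIV f y :> g y"
    "\<And>y. y \<in> S \<Longrightarrow> (g has_derivative D y) (at y)" "\<And>h. continuous_on S (\<lambda>y. D y h)"
    using assms(1) by (rule C2_onE) (rule that, assumption+)
  have sh: "((\<lambda>y. y - a) has_derivative (\<lambda>h. h)) (at y)" for y
    by (auto intro!: derivative_eq_intros)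
  show ?thesis
  proof (rule C2_onI[where g = "\<lambda>y. g (y - a)" and D = "\<lambda>y. D (y - a)"])
    show "open ((+) a ` S)" using 1(1) by (rule open_translation)
    show "continuous_on ((+) a ` S) (\<lambda>y. D (y - a) h)" for h
      by (rule continuous_on_compose2[OF 1(4)]) (auto intro!: continuous_intros)
    fix y assume "y \<in> (+) a ` S"
    then have y: "y - a \<in> S" by auto
    show "GDERIV (\<lambda>y. f (y - a)) y :> g (y - a)"
      using has_derivative_compose[OF sh 1(2)[OF y, unfolded gderiv_def]] by (simp add: gderiv_def)
    show "((\<lambda>y. g (y - a)) has_derivative D (y - a)) (at y)"
      using has_derivative_compose[OF sh 1(3)[OF y]] by simp
  qed
qed

lemma C2_on_polynomial:
  assumes "real_polynomial_function f" "open S" shows "C2_on S f"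
  using assms
  by induction (auto intro: C2_on_linear C2_on_const C2_on_add C2_on_mult)

lemma C2_on_sum:
  assumes "finite J" "\<And>j. j \<in> J \<Longrightarrow> C2_on S (f j)" "open S"
  shows "C2_on S (\<lambda>y. \<Sum>j\<in>J. f j y)"
  using assms by (induction) (auto intro: C2_on_const C2_on_add)

lemma C2_on_pos_part_power3:
  assumes "C2_on S f" shows "C2_on S (\<lambda>y. (max 0 (f y)) ^ 3)"
proof (rule C2_on_compose[OF assms])
  have pow: "((\<lambda>t. (max 0 t) ^ Suc (Suc m)) has_real_derivative of_nat (Suc (Suc m)) * (max 0 t) ^ Suc m) (at t)"
    for t :: real and m
  proof (cases "t = 0")
    case False
    show ?thesis
    proof (cases "t > 0")
      case True
      have "((\<lambda>t. t ^ Suc (Suc m)) has_real_derivative of_nat (Suc (Suc m)) * t ^ Suc m) (at t)"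
        using DERIV_pow[of "Suc (Suc m)" t] by (simp only: diff_Suc_Suc diff_zero)
      then have "((\<lambda>t. (max 0 t) ^ Suc (Suc m)) has_real_derivative of_nat (Suc (Suc m)) * t ^ Suc m) (at t)"
        by (rule has_field_derivative_transform_within_open[of _ _ _ "{0<..}"]) (use True in auto)
      then show ?thesis using True by simp
    next
      case f: False
      have "((\<lambda>t. (max 0 t) ^ Suc (Suc m)) has_real_derivative 0) (at t)"
        by (rule has_field_derivative_transform_within_open[of "\<lambda>_. 0" _ _ "{..<0}"]) (use f False in auto)
      then show ?thesis using f by simp
    qed
  next
    case True
    have "(\<lambda>h. (max 0 h) ^ Suc (Suc m) / h) = (\<lambda>h::real. (max 0 h) ^ Suc m)"
      by (auto simp: fun_eq_iff max_def)
    moreover have "isCont (\<lambda>h::real. (max 0 h) ^ Suc m) 0"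
      by (intro continuous_intros)
    ultimately show ?thesis
      using True by (simp add: DERIV_def isCont_def)
  qed
  show "((\<lambda>t. (max 0 t) ^ 3) has_real_derivative 3 * (max 0 t)\<^sup>2) (at t)" for t :: real
    using pow[of 1 t] by (simp add: numeral_eq_Suc)
  show "((\<lambda>t. 3 * (max 0 t)\<^sup>2) has_real_derivative 3 * (2 * max 0 t)) (at t)" for t :: real
    using DERIV_cmult[OF pow[of 0 t], of 3] by (simp add: numeral_eq_Suc)
  show "continuous_on UNIV (\<lambda>t::real. 3 * (2 * max 0 t))"
    by (intro continuous_intros)
qed

section \<open>Taylor expansion and symmetry of the Hessian\<close>

lemma gradient_expansion:
  assumes "C2 f" "0 < e"
  obtains d where "0 < d" "\<And>z. norm z \<le> d \<Longrightarrow>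
    norm (grad f (x + z) - grad f x - hess f x *v z) \<le> e * norm z"
proof -
  have "(grad f has_derivative (*v) (hess f x)) (at x)"
    using assms by (simp add: C2_hess)
  then obtain d where d: "0 < d" "\<And>y. norm (y - x) < d \<Longrightarrow>
      norm (grad f y - grad f x - hess f x *v (y - x)) \<le> e * norm (y - x)"
    using assms(2) unfolding has_derivative_at_alt by blast
  show ?thesis
  proof (rule that[of "d / 2"])
    show "norm (grad f (x + z) - grad f x - hess f x *v z) \<le> e * norm z"
      if "norm z \<le> d / 2" for z
      using d(1) d(2)[of "x + z"] that by simp
  qed (use d in auto)
qed

lemma DERIV_along_line:
  assumes "C2 f"
  shows "((\<lambda>s. f (a + s *\<^sub>R b)) has_real_derivative b \<bullet> grad f (a + s *\<^sub>R b)) (at s)"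
proof -
  have "((\<lambda>s. a + s *\<^sub>R b) has_derivative (\<lambda>h. h *\<^sub>R b)) (at s)"
    by (auto intro!: derivative_eq_intros)
  moreover have "(f has_derivative (\<lambda>h. h \<bullet> grad f (a + s *\<^sub>R b))) (at (a + s *\<^sub>R b))"
    using C2_grad[OF assms] by (simp add: gderiv_def)
  ultimately have "((\<lambda>s. f (a + s *\<^sub>R b)) has_derivative (\<lambda>h. (h *\<^sub>R b) \<bullet> grad f (a + s *\<^sub>R b))) (at s)"
    by (rule has_derivative_compose)
  then show ?thesis
    by (simp add: has_field_derivative_def mult_commute_abs)
qed

text \<open>The mean value theorem applied to \<open>s \<mapsto> f (x + ta + sb) - f (x + sb)\<close> turns the second difference into
  a first difference of the gradient.\<close>

lemma second_difference:
  assumes "C2 f" "0 < e"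
  obtains d where "0 < d" "\<And>t. 0 < t \<Longrightarrow> t \<le> d \<Longrightarrow>
    \<bar>f (x + t *\<^sub>R a + t *\<^sub>R b) - f (x + t *\<^sub>R a) - f (x + t *\<^sub>R b) + f x - t\<^sup>2 * (b \<bullet> (hess f x *v a))\<bar>
      \<le> e * (norm a + 2 * norm b) * norm b * t\<^sup>2"
proof -
  obtain d where d: "0 < d" "\<And>z. norm z \<le> d \<Longrightarrow>
      norm (grad f (x + z) - grad f x - hess f x *v z) \<le> e * norm z"
    using gradient_expansion[OF assms, of x] by blast
  let ?H = "hess f x"
  define d' where "d' = d / (norm a + norm b + 1)"
  have pos: "norm a + norm b + 1 > 0" by (smt (verit) norm_ge_zero)
  show ?thesis
  proof (rule that[of d'])
    show "0 < d'" using d(1) pos by (simp add: d'_def)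
    fix t :: real assume t: "0 < t" "t \<le> d'"
    have td: "t * (norm a + norm b) \<le> d"
    proof -
      have "t * (norm a + norm b) \<le> t * (norm a + norm b + 1)" using t by simp
      also have "\<dots> \<le> d" using t pos by (simp add: d'_def field_simps)
      finally show ?thesis .
    qed
    define w where "w s = f (x + t *\<^sub>R a + s *\<^sub>R b) - f (x + s *\<^sub>R b)" for s
    have w': "(w has_real_derivative b \<bullet> (grad f (x + t *\<^sub>R a + s *\<^sub>R b) - grad f (x + s *\<^sub>R b))) (at s)" for s
      unfolding w_def inner_diff_right by (intro DERIV_diff DERIV_along_line assms(1))
    obtain s where s: "0 < s" "s < t"
      "w t - w 0 = (t - 0) * (b \<bullet> (grad f (x + t *\<^sub>R a + s *\<^sub>R b) - grad f (x + s *\<^sub>R b)))"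
      using MVT2[OF t(1) w'] by blast
    have sb: "norm (s *\<^sub>R b) \<le> t * norm b"
      using s by (simp add: mult_right_mono)
    have ab: "norm (t *\<^sub>R a + s *\<^sub>R b) \<le> t * norm a + t * norm b"
      using norm_triangle_ineq[of "t *\<^sub>R a" "s *\<^sub>R b"] sb t by simp
    have "norm (t *\<^sub>R a + s *\<^sub>R b) \<le> d" using ab td by (simp add: algebra_simps)
    then have 1: "norm (grad f (x + (t *\<^sub>R a + s *\<^sub>R b)) - grad f x - ?H *v (t *\<^sub>R a + s *\<^sub>R b))
        \<le> e * (t * norm a + t * norm b)"
      using d(2)[of "t *\<^sub>R a + s *\<^sub>R b"] ab assms(2) by (meson mult_left_mono less_imp_le order_trans)
    have "0 \<le> t * norm a" using t(1) by simp
    then have "t * norm b \<le> d" using td by (simp add: distrib_left)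
    then have 2: "norm (grad f (x + s *\<^sub>R b) - grad f x - ?H *v (s *\<^sub>R b)) \<le> e * (t * norm b)"
      using d(2)[of "s *\<^sub>R b"] sb assms(2) by (meson mult_left_mono less_imp_le order_trans)
    have "norm (grad f (x + t *\<^sub>R a + s *\<^sub>R b) - grad f (x + s *\<^sub>R b) - t *\<^sub>R (?H *v a))
        \<le> e * (t * norm a + t * norm b) + e * (t * norm b)"
      using norm_triangle_le_diff[OF add_mono[OF 1 2]]
      by (simp add: matrix_vector_right_distrib matrix_vector_mult_scaleR algebra_simps)
    also have "\<dots> = e * t * (norm a + 2 * norm b)" by (simp add: algebra_simps)
    finally have 3: "norm (grad f (x + t *\<^sub>R a + s *\<^sub>R b) - grad f (x + s *\<^sub>R b) - t *\<^sub>R (?H *v a))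
        \<le> e * t * (norm a + 2 * norm b)" .
    have "f (x + t *\<^sub>R a + t *\<^sub>R b) - f (x + t *\<^sub>R a) - f (x + t *\<^sub>R b) + f x - t\<^sup>2 * (b \<bullet> (?H *v a))
        = w t - w 0 - t * (b \<bullet> (t *\<^sub>R (?H *v a)))"
      by (simp add: w_def power2_eq_square)
    also have "\<dots> = t * (b \<bullet> (grad f (x + t *\<^sub>R a + s *\<^sub>R b) - grad f (x + s *\<^sub>R b) - t *\<^sub>R (?H *v a)))"
      by (simp add: s(3) inner_diff_right right_diff_distrib)
    also have "\<bar>\<dots>\<bar> \<le> t * (norm b * (e * t * (norm a + 2 * norm b)))"
      unfolding abs_mult using t
      by (intro mult_mono order_trans[OF Cauchy_Schwarz_ineq2] mult_left_mono[OF 3]) auto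
    also have "\<dots> = e * (norm a + 2 * norm b) * norm b * t\<^sup>2"
      by (simp add: power2_eq_square)
    finally show "\<bar>f (x + t *\<^sub>R a + t *\<^sub>R b) - f (x + t *\<^sub>R a) - f (x + t *\<^sub>R b) + f x
        - t\<^sup>2 * (b \<bullet> (?H *v a))\<bar> \<le> e * (norm a + 2 * norm b) * norm b * t\<^sup>2" .
  qed
qed

text \<open>The second difference of \<open>f\<close> in the directions \<open>a\<close> and \<open>b\<close> is symmetric in \<open>a\<close> and \<open>b\<close>, and so
  is its leading coefficient.\<close>

lemma hess_symmetric:
  assumes "C2 f"
  shows "hess f x \<in> sym_matrices"
proof -
  have eq: "b \<bullet> (hess f x *v a) = a \<bullet> (hess f x *v b)" for a b
  proof -
    let ?p = "b \<bullet> (hess f x *v a)" and ?q = "a \<bullet> (hess f x *v b)"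
    define K where "K = (norm a + 2 * norm b) * norm b + (norm b + 2 * norm a) * norm a + 1"
    have K: "K > 0" unfolding K_def by (intro add_nonneg_pos add_nonneg_nonneg mult_nonneg_nonneg) auto
    have "\<bar>?p - ?q\<bar> \<le> e" if "e > 0" for e
    proof -
      have eK: "e / K > 0" using that K by simp
      obtain d1 where d1: "0 < d1" "\<And>t. 0 < t \<Longrightarrow> t \<le> d1 \<Longrightarrow>
          \<bar>f (x + t *\<^sub>R a + t *\<^sub>R b) - f (x + t *\<^sub>R a) - f (x + t *\<^sub>R b) + f x - t\<^sup>2 * ?p\<bar>
          \<le> e / K * (norm a + 2 * norm b) * norm b * t\<^sup>2"
        using second_difference[OF assms eK, of x a b] by blast
      obtain d2 where d2: "0 < d2" "\<And>t. 0 < t \<Longrightarrow> t \<le> d2 \<Longrightarrow>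
          \<bar>f (x + t *\<^sub>R b + t *\<^sub>R a) - f (x + t *\<^sub>R b) - f (x + t *\<^sub>R a) + f x - t\<^sup>2 * ?q\<bar>
          \<le> e / K * (norm b + 2 * norm a) * norm a * t\<^sup>2"
        using second_difference[OF assms eK, of x b a] by blast
      define t where "t = min d1 d2"
      have t: "0 < t" "t \<le> d1" "t \<le> d2" using d1 d2 by (auto simp: t_def)
      have sw: "x + t *\<^sub>R b + t *\<^sub>R a = x + t *\<^sub>R a + t *\<^sub>R b" by simp
      have "\<bar>t\<^sup>2 * ?p - t\<^sup>2 * ?q\<bar> \<le> e / K * (norm a + 2 * norm b) * norm b * t\<^sup>2
          + e / K * (norm b + 2 * norm a) * norm a * t\<^sup>2"
        using d1(2)[OF t(1,2)] d2(2)[OF t(1,3)] unfolding sw by (simp only: abs_le_iff) linarith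
      also have "\<dots> = e / K * ((norm a + 2 * norm b) * norm b + (norm b + 2 * norm a) * norm a) * t\<^sup>2"
        by (simp only: distrib_left distrib_right mult.assoc)
      also have "\<dots> = e / K * (K - 1) * t\<^sup>2" unfolding K_def by simp
      also have "\<dots> \<le> e * t\<^sup>2" using K that by (intro mult_right_mono) (auto simp: field_simps)
      finally have "t\<^sup>2 * \<bar>?p - ?q\<bar> \<le> t\<^sup>2 * e"
        unfolding right_diff_distrib[symmetric] abs_mult by (simp add: mult.commute[of e])
      then show ?thesis using t(1) by simp
    qed
    then have "\<bar>?p - ?q\<bar> \<le> 0" by (metis add_0 field_le_epsilon)
    then show ?thesis by simp
  qed
  have "a \<bullet> (transpose (hess f x) *v b) = a \<bullet> (hess f x *v b)" for a b
    by (simp add: transpose_matrix_vector inner_commute[of a "b v* _"] dot_lmul_matrix eq)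
  then have 1: "transpose (hess f x) *v b = hess f x *v b" for b
    by (metis vector_eq_ldot)
  then show ?thesis
    unfolding sym_matrices_def by (simp add: matrix_eq)
qed

lemma taylor_expansion:
  assumes "C2 f" "0 < \<delta>"
  obtains \<epsilon> where "0 < \<epsilon>" "\<And>z. norm z \<le> \<epsilon> \<Longrightarrow>
    \<bar>f (x + z) - f x - grad f x \<bullet> z - 1/2 * quad (hess f x) z\<bar> \<le> \<delta> * (norm z)\<^sup>2"
proof -
  obtain d where d: "0 < d" "\<And>z. norm z \<le> d \<Longrightarrow>
      norm (grad f (x + z) - grad f x - hess f x *v z) \<le> \<delta> * norm z"
    using gradient_expansion[OF assms, of x] by blast
  have "\<bar>f (x + z) - f x - grad f x \<bullet> z - 1/2 * quad (hess f x) z\<bar> \<le> \<delta> * (norm z)\<^sup>2"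
    if z: "norm z \<le> d" for z
  proof -
    define w where "w s = f (x + s *\<^sub>R z) - s * (grad f x \<bullet> z) - s\<^sup>2 / 2 * quad (hess f x) z" for s
    have w': "(w has_real_derivative
        z \<bullet> (grad f (x + s *\<^sub>R z) - grad f x - hess f x *v (s *\<^sub>R z))) (at s)" for s
      unfolding w_def inner_diff_right matrix_vector_mult_scaleR inner_scaleR_right
      by (auto intro!: derivative_eq_intros DERIV_along_line[OF assms(1)]
          simp: quad_def inner_commute)
    obtain s where s: "0 < s" "s < 1"
      "w 1 - w 0 = (1 - 0) * (z \<bullet> (grad f (x + s *\<^sub>R z) - grad f x - hess f x *v (s *\<^sub>R z)))"
      using MVT2[OF zero_less_one w'] by blast
    have sz: "norm (s *\<^sub>R z) \<le> norm z" using s by (simp add: mult_left_le_one_le)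
    have "\<bar>w 1 - w 0\<bar> \<le> norm z * norm (grad f (x + s *\<^sub>R z) - grad f x - hess f x *v (s *\<^sub>R z))"
      using s(3) Cauchy_Schwarz_ineq2 by simp
    also have "\<dots> \<le> norm z * (\<delta> * norm (s *\<^sub>R z))"
      using d(2)[of "s *\<^sub>R z"] sz z by (intro mult_left_mono) auto
    also have "\<dots> \<le> norm z * (\<delta> * norm z)"
      using sz assms(2) by (intro mult_left_mono) auto
    finally show ?thesis
      by (simp add: w_def power2_eq_square algebra_simps)
  qed
  with d(1) show ?thesis using that by blast
qed

section \<open>Polynomial majorants of semicontinuous functions\<close>

lemma usc_borel_measurable:
  assumes "usc u" shows "u \<in> borel_measurable borel"
  using assms unfolding usc_def by (intro borel_measurable_iff_less[THEN iffD2]) auto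

lemma usc_max_const:
  assumes "usc u" shows "usc (\<lambda>y. max (u y) c)"
  unfolding usc_def
proof
  fix a show "open {y. max (u y) c < a}"
    using assms by (cases "c < a") (auto simp: usc_def)
qed

lemma usc_translate:
  assumes "usc u" shows "usc (\<lambda>z. u (x + z))"
  unfolding usc_def
proof
  fix a
  have "open ((\<lambda>z. x + z) -` {y. u y < a})"
    using assms by (intro open_vimage continuous_intros) (auto simp: usc_def)
  then show "open {z. u (x + z) < a}" by (simp add: vimage_def)
qed

lemma usc_bounded_above_on_compact:
  fixes K :: "(real^'n) set"
  assumes "usc u" "compact K"
  obtains B where "\<And>y. y \<in> K \<Longrightarrow> u y \<le> B"
proof -
  have op: "open {y. u y < real n}" for n using assms(1) by (simp add: usc_def)
  have cov: "K \<subseteq> (\<Union>n\<in>UNIV. {y. u y < real n})"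
    using reals_Archimedean2 by auto
  obtain C where C: "finite C" "K \<subseteq> (\<Union>n\<in>C. {y. u y < real n})"
    using compactE_image[OF assms(2) op cov] by metis
  have "u y \<le> real (Max (insert 0 C))" if "y \<in> K" for y
  proof -
    have "\<exists>n\<in>C. u y < real n" using C(2) that by blast
    then obtain n where n: "n \<in> C" "u y < real n" by blast
    then have "real n \<le> real (Max (insert 0 C))" using C(1) by simp
    with n show ?thesis by linarith
  qed
  then show ?thesis by (rule that)
qed

text \<open>On a compact set, the sup-convolutions of an upper semicontinuous function are continuous and
  converge to it from above; a polynomial close to one of them is the required majorant.\<close>

lemma usc_polynomial_majorant:
  fixes K :: "(real^'n) set" and w :: "real^'n \<Rightarrow> real"
  assumes K: "compact K" and w: "usc w" and c: "\<And>y. y \<in> K \<Longrightarrow> c \<le> w y"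
    and q: "sets q = sets borel" and fin: "emeasure q K < \<infinity>" and e: "0 < e"
  obtains P where "real_polynomial_function P" "\<And>y. y \<in> K \<Longrightarrow> w y \<le> P y"
    "(\<integral>\<^sup>+y\<in>K. ennreal (P y - w y) \<partial>q) \<le> ennreal e"
proof (cases "K = {}")
  case True
  then show ?thesis using that[of "\<lambda>_. 0"] by auto
next
  case False
  obtain B where B: "\<And>y. y \<in> K \<Longrightarrow> w y \<le> B"
    using usc_bounded_above_on_compact[OF w K] by blast
  \<comment> \<open>The sup-convolution \<open>f k\<close> is Lipschitz with constant \<open>k\<close>.\<close>
  define f where "f k y = (SUP y'\<in>K. w y' - real k * dist y y')" for k :: nat and y
  have bdd: "bdd_above ((\<lambda>y'. w y' - real k * dist y y') ` K)" for k y
    by (rule bdd_aboveI2[where M = B]) (use B in \<open>smt (verit) mult_nonneg_nonneg of_nat_0_le_iff zero_le_dist\<close>)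
  have lower: "w y \<le> f k y" if "y \<in> K" for k y
    using cSUP_upper[OF that bdd[of k y]] by (simp add: f_def)
  have upper: "f k y \<le> B" for k y
    unfolding f_def
    by (rule cSUP_least[OF False]) (use B in \<open>smt (verit) mult_nonneg_nonneg of_nat_0_le_iff zero_le_dist\<close>)
  have lip: "f k y \<le> f k y' + real k * dist y y'" for k y y'
    unfolding f_def
  proof (rule cSUP_least[OF False])
    fix v assume v: "v \<in> K"
    have "w v - real k * dist y' v \<le> (SUP v\<in>K. w v - real k * dist y' v)"
      by (rule cSUP_upper[OF v bdd])
    moreover have "real k * dist y' v \<le> real k * dist y v + real k * dist y y'"
      using mult_left_mono[OF dist_triangle[of y' v y], of "real k"]
      by (simp add: dist_commute algebra_simps)
    ultimately show "w v - real k * dist y v \<le> (SUP v\<in>K. w v - real k * dist y' v) + real k * dist y y'"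
      by linarith
  qed
  have cont: "continuous_on UNIV (f k)" for k
  proof (rule continuous_onI)
    fix y and e :: real assume "0 < e"
    have "dist (f k y') (f k y) \<le> e" if "dist y' y < e / (real k + 1)" for y'
    proof -
      have "dist (f k y') (f k y) \<le> real k * dist y' y"
        using lip[of k y y'] lip[of k y' y] by (simp add: dist_real_def dist_commute abs_le_iff)
      also have "\<dots> \<le> (real k + 1) * dist y' y" by (simp add: mult_right_mono)
      also have "\<dots> \<le> e" using that by (simp add: field_simps)
      finally show ?thesis .
    qed
    then show "\<exists>d>0. \<forall>x'\<in>UNIV. dist x' y < d \<longrightarrow> dist (f k x') (f k y) \<le> e"
      using \<open>0 < e\<close> by (intro exI[of _ "e / (real k + 1)"]) auto
  qed
  have conv: "(\<lambda>k. f k y) \<longlonglongrightarrow> w y" if y: "y \<in> K" for y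
  proof (rule LIMSEQ_I)
    fix e :: real assume e: "0 < e"
    have "open {v. w v < w y + e / 2}" using w by (simp add: usc_def)
    then obtain d where d: "0 < d" "\<And>v. dist v y < d \<Longrightarrow> w v < w y + e / 2"
      unfolding open_dist using e by (metis half_gt_zero less_add_same_cancel1 mem_Collect_eq)
    obtain k0 :: nat where k0: "(B - c) / d < real k0" using reals_Archimedean2 by blast
    have "norm (f k y - w y) < e" if "k \<ge> k0" for k
    proof -
      have "f k y \<le> w y + e / 2"
        unfolding f_def
      proof (rule cSUP_least[OF False])
        fix v assume v: "v \<in> K"
        show "w v - real k * dist y v \<le> w y + e / 2"
        proof (cases "dist v y < d")
          case True
          then have "w v < w y + e / 2" by (rule d(2))
          then show ?thesis by (smt (verit) mult_nonneg_nonneg of_nat_0_le_iff zero_le_dist)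
        next
          case False
          have "B - c \<le> real k0 * d" using k0 d(1) by (simp add: field_simps)
          also have "\<dots> \<le> real k * dist y v"
            using False that d(1) by (intro mult_mono) (auto simp: dist_commute)
          finally show ?thesis using B[OF v] c[OF y] e by linarith
        qed
      qed
      with lower[OF y, of k] e show ?thesis by simp
    qed
    then show "\<exists>no. \<forall>n\<ge>no. norm (f n y - w y) < e" by blast
  qed
  have mw: "w \<in> borel_measurable q"
    using usc_borel_measurable[OF w] q by (simp cong: measurable_cong_sets)
  have mf: "f k \<in> borel_measurable q" for k
    using borel_measurable_continuous_onI[OF cont] q by (simp cong: measurable_cong_sets)
  have mK: "K \<in> sets q" using K q by (simp add: compact_imp_closed)
  have Kint: "integrable q (\<lambda>y. indicator K y * a)" for a :: real
    using fin mK by (intro integrable_mult_indicator[of K q "\<lambda>_. a", simplified] integrable_mult_left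
      integrable_real_indicator) auto
  have bound_diff: "f k y - w y \<le> B - c" if "y \<in> K" for k y
    using upper[of k y] c[OF that] by linarith
  have dom: "(\<lambda>k. LINT y|q. indicator K y * (f k y - w y)) \<longlonglongrightarrow> (LINT y|q. 0)"
  proof (rule integral_dominated_convergence[where w = "\<lambda>y. indicator K y * (B - c)"])
    show "AE y in q. (\<lambda>k. indicator K y * (f k y - w y)) \<longlonglongrightarrow> 0"
    proof (rule AE_I2)
      fix y show "(\<lambda>k. indicator K y * (f k y - w y)) \<longlonglongrightarrow> 0"
      proof (cases "y \<in> K")
        case True
        then show ?thesis using tendsto_diff[OF conv[OF True] tendsto_const[of "w y"]] by simp
      qed auto
    qed
    show "AE y in q. norm (indicator K y * (f k y - w y)) \<le> indicator K y * (B - c)" for k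
      by (rule AE_I2) (use lower bound_diff in \<open>simp add: indicator_def\<close>)
  qed (use mw mf mK Kint in auto)
  then have "eventually (\<lambda>k. (LINT y|q. indicator K y * (f k y - w y)) < e / 2) sequentially"
    by (rule order_tendstoD) (use e in simp)
  then obtain k where k: "(LINT y|q. indicator K y * (f k y - w y)) < e / 2"
    by (meson eventually_sequentially order_refl)
  \<comment> \<open>Shifting \<open>f k\<close> upwards by the approximation error keeps the polynomial above \<open>w\<close>.\<close>
  define a where "a = e / (4 * (measure q K + 1))"
  have m0: "measure q K + 1 > 0" by (simp add: add_nonneg_pos)
  then have a: "0 < a" using e by (simp add: a_def)
  obtain P where P: "real_polynomial_function P" "\<And>y. y \<in> K \<Longrightarrow> \<bar>(f k y + a) - P y\<bar> < a"
    using Stone_Weierstrass_real_polynomial_function[OF K _ a, of "\<lambda>y. f k y + a"]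
      continuous_on_subset[OF cont] continuous_on_add[OF _ continuous_on_const] by blast
  show ?thesis
  proof (rule that[OF P(1)])
    show "w y \<le> P y" if "y \<in> K" for y
      using P(2)[OF that] lower[OF that, of k] by linarith
    have int: "integrable q (\<lambda>y. indicator K y * (f k y - w y))"
      by (rule Bochner_Integration.integrable_bound[OF Kint[of "B - c"]])
        (use mw mf mK lower bound_diff in \<open>auto simp: indicator_def intro!: AE_I2 order_trans[OF bound_diff]\<close>)
    have "(\<integral>\<^sup>+y\<in>K. ennreal (P y - w y) \<partial>q)
        \<le> (\<integral>\<^sup>+y. ennreal (indicator K y * (f k y - w y) + indicator K y * (2 * a)) \<partial>q)"
    proof (rule nn_integral_mono)
      fix y
      show "ennreal (P y - w y) * indicator K y
          \<le> ennreal (indicator K y * (f k y - w y) + indicator K y * (2 * a))"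
        using P(2)[of y] by (cases "y \<in> K") (auto intro!: ennreal_leI)
    qed
    also have "\<dots> = ennreal (LINT y|q. indicator K y * (f k y - w y) + indicator K y * (2 * a))"
      using Bochner_Integration.integrable_add[OF int Kint[of "2 * a"]]
      by (rule nn_integral_eq_integral) (use lower a in \<open>auto simp: indicator_def\<close>)
    also have "(LINT y|q. indicator K y * (f k y - w y) + indicator K y * (2 * a))
        = (LINT y|q. indicator K y * (f k y - w y)) + measure q K * (2 * a)"
      using int Kint mK fin by (simp add: Bochner_Integration.integral_add)
    also have "\<dots> \<le> e"
    proof -
      have "measure q K * (2 * a) \<le> e / 2"
        using m0 e by (simp add: a_def field_simps)
      with k show ?thesis by linarith
    qed
    finally show "(\<integral>\<^sup>+y\<in>K. ennreal (P y - w y) \<partial>q) \<le> ennreal e"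
      by (simp add: ennreal_leI)
  qed
qed

section \<open>A radial partition of unity\<close>

text \<open>The cubic spline \<open>smoothstep\<close> is the integral of the quadratic B-spline with knots
  \<open>0, 1, 2, 3\<close>. It is of class \<open>C\<^sup>2\<close>, vanishes on the left of \<open>0\<close> and equals \<open>1\<close> on the right
  of \<open>3\<close>.\<close>

definition smoothstep :: "real \<Rightarrow> real" where
  "smoothstep t = (max 0 t ^ 3 - 3 * max 0 (t - 1) ^ 3 + 3 * max 0 (t - 2) ^ 3 - max 0 (t - 3) ^ 3) / 6"

lemma smoothstep_eq_0: "t \<le> 0 \<Longrightarrow> smoothstep t = 0"
  by (simp add: smoothstep_def max_def)

lemma smoothstep_eq_1: "3 \<le> t \<Longrightarrow> smoothstep t = 1"
  by (simp add: smoothstep_def max_def power3_eq_cube algebra_simps)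

lemma smoothstep_bounds: "0 \<le> smoothstep t" "smoothstep t \<le> 1"
proof -
  consider "t \<le> 0" | "0 \<le> t" "t \<le> 1" | "1 \<le> t" "t \<le> 2" | "2 \<le> t" "t \<le> 3" | "3 \<le> t" by linarith
  then have "0 \<le> smoothstep t \<and> smoothstep t \<le> 1"
  proof cases
    case 2
    then have "smoothstep t = t ^ 3 / 6" by (auto simp: smoothstep_def max_def)
    moreover have "0 \<le> t ^ 3" "t ^ 3 \<le> 1" using 2 by (auto intro: power_le_one)
    ultimately show ?thesis by - (intro conjI; linarith)
  next
    case 3
    define s where "s = t - 1"
    have s: "0 \<le> s" "s \<le> 1" "t = s + 1" using 3 by (auto simp: s_def)
    have "smoothstep t = (t ^ 3 - 3 * (t - 1) ^ 3) / 6"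
      using 3 by (auto simp: smoothstep_def max_def)
    also have "\<dots> = (1 + 3 * s + 3 * s\<^sup>2 - 2 * s ^ 3) / 6"
      by (simp add: s(3) power3_eq_cube power2_eq_square algebra_simps)
    finally have *: "smoothstep t = (1 + 3 * s + 3 * s\<^sup>2 - 2 * s ^ 3) / 6" .
    have p: "s\<^sup>2 \<le> s" "s ^ 3 \<le> s\<^sup>2" "0 \<le> s\<^sup>2" "0 \<le> s ^ 3"
      using s power_decreasing[of 1 2 s] power_decreasing[of 2 3 s] by auto
    have "s * (1 - s)\<^sup>2 \<ge> 0" using s by simp
    then have "2 * s\<^sup>2 \<le> s + s ^ 3"
      by (simp add: power2_eq_square power3_eq_cube algebra_simps)
    then have "0 \<le> 1 + 3 * s + 3 * s\<^sup>2 - 2 * s ^ 3" "1 + 3 * s + 3 * s\<^sup>2 - 2 * s ^ 3 \<le> 6"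
      using p s(1,2) by linarith+
    then show ?thesis unfolding * by simp
  next
    case 4
    have "smoothstep t = (t ^ 3 - 3 * (t - 1) ^ 3 + 3 * (t - 2) ^ 3) / 6"
      using 4 by (auto simp: smoothstep_def max_def)
    also have "\<dots> = (6 - (3 - t) ^ 3) / 6"
      by (simp add: power3_eq_cube algebra_simps)
    finally have *: "smoothstep t = (6 - (3 - t) ^ 3) / 6" .
    have "0 \<le> (3 - t) ^ 3" "(3 - t) ^ 3 \<le> 1" using 4 by (auto intro: power_le_one)
    then show ?thesis unfolding * by simp
  qed (simp_all add: smoothstep_eq_0 smoothstep_eq_1)
  then show "0 \<le> smoothstep t" "smoothstep t \<le> 1" by auto
qed

lemma C2_on_smoothstep:
  assumes "C2_on S f" shows "C2_on S (\<lambda>y. smoothstep (f y))"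
proof -
  have S: "open S" using assms by (simp add: C2_on_def)
  have sh: "C2_on S (\<lambda>y. f y - a)" for a
    using C2_on_add[OF assms C2_on_const[OF S, of "- a"]] by simp
  have p: "C2_on S (\<lambda>y. b * max 0 (f y - a) ^ 3)" for a b
    by (intro C2_on_mult C2_on_const S C2_on_pos_part_power3 sh)
  have "C2_on S (\<lambda>y. ((1/6) * max 0 (f y - 0) ^ 3 + (-1/2) * max 0 (f y - 1) ^ 3)
      + ((1/2) * max 0 (f y - 2) ^ 3 + (-1/6) * max 0 (f y - 3) ^ 3))"
    by (intro C2_on_add p)
  then show ?thesis
    by (rule C2_on_cong) (simp add: smoothstep_def field_simps)
qed

lemma C2_on_norm_square: "open S \<Longrightarrow> C2_on S (\<lambda>z. (norm z)\<^sup>2)"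
proof -
  assume S: "open S"
  have "C2_on S (\<lambda>z. \<Sum>i\<in>UNIV. z $ i * z $ i)"
    by (intro C2_on_sum C2_on_mult C2_on_linear bounded_linear_vec_nth S) auto
  then show ?thesis
    by (rule C2_on_cong) (simp add: power2_norm_eq_inner inner_vec_def)
qed

text \<open>For \<open>0 < r \<le> 1\<close> the cutoff functions increase to \<open>1\<close> with \<open>j\<close>. The one with index \<open>0\<close> vanishes
  outside the ball of radius \<open>r\<close> and equals \<open>1\<close> on the ball of radius \<open>r / 2\<close>. The one with index
  \<open>j > 0\<close> equals \<open>1\<close> where \<open>\<bar>z\<bar>\<^sup>2 \<le> 3j\<close> and vanishes where \<open>\<bar>z\<bar>\<^sup>2 \<ge> 3j + 3\<close>.\<close>

definition cutoff :: "real \<Rightarrow> nat \<Rightarrow> real^'n \<Rightarrow> real" where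
  "cutoff r j z = 1 - smoothstep (if j = 0 then 4 / r\<^sup>2 * (norm z)\<^sup>2 - 1 else (norm z)\<^sup>2 - 3 * real j)"

lemma cutoff_bounds: "0 \<le> cutoff r j z" "cutoff r j z \<le> 1"
  using smoothstep_bounds by (auto simp: cutoff_def)

lemma C2_on_cutoff: "open S \<Longrightarrow> C2_on S (cutoff r j)"
proof -
  assume S: "open S"
  have "C2_on S (\<lambda>z. 1 + (-1) * smoothstep ((if j = 0 then 4 / r\<^sup>2 else 1) * (norm z)\<^sup>2 +
      (if j = 0 then - 1 else - 3 * real j)))"
    by (intro C2_on_add C2_on_mult C2_on_const C2_on_smoothstep C2_on_norm_square S)
  then show ?thesis
    by (rule C2_on_cong) (simp add: cutoff_def)
qed

lemma cutoff_0_inner: "0 < r \<Longrightarrow> norm z \<le> r / 2 \<Longrightarrow> cutoff r 0 z = 1"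
proof -
  assume r: "0 < r" and z: "norm z \<le> r / 2"
  have "(norm z)\<^sup>2 \<le> (r / 2)\<^sup>2" using z by (intro power_mono) auto
  then have "4 / r\<^sup>2 * (norm z)\<^sup>2 - 1 \<le> 0" using r by (simp add: field_simps power2_eq_square)
  then show ?thesis by (simp add: cutoff_def smoothstep_eq_0)
qed

lemma cutoff_0_outer: "0 < r \<Longrightarrow> r \<le> norm z \<Longrightarrow> cutoff r 0 z = 0"
proof -
  assume r: "0 < r" and z: "r \<le> norm z"
  have "r\<^sup>2 \<le> (norm z)\<^sup>2" using z r by (intro power_mono) auto
  then have "3 \<le> 4 / r\<^sup>2 * (norm z)\<^sup>2 - 1" using r by (simp add: field_simps power2_eq_square)
  then show ?thesis by (simp add: cutoff_def smoothstep_eq_1)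
qed

lemma cutoff_inner: "0 < j \<Longrightarrow> (norm z)\<^sup>2 \<le> 3 * real j \<Longrightarrow> cutoff r j z = 1"
  by (simp add: cutoff_def smoothstep_eq_0)

lemma cutoff_outer: "0 < r \<Longrightarrow> r \<le> 1 \<Longrightarrow> 3 * real j + 3 \<le> (norm z)\<^sup>2 \<Longrightarrow> cutoff r j z = 0"
proof (cases "j = 0")
  case True
  assume r: "0 < r" "r \<le> 1" and z: "3 * real j + 3 \<le> (norm z)\<^sup>2"
  have "1\<^sup>2 \<le> (norm z)\<^sup>2" using z True by simp
  then have "1 \<le> norm z" by (rule power2_le_imp_le) simp
  then show ?thesis using cutoff_0_outer[of r z] r True by simp
qed (simp add: cutoff_def smoothstep_eq_1)

text \<open>The increments of the cutoff functions. Together with \<open>cutoff r 0\<close> they form a locally finite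
  partition of unity.\<close>

definition shell :: "real \<Rightarrow> nat \<Rightarrow> real^'n \<Rightarrow> real" where
  "shell r j z = cutoff r (Suc j) z - cutoff r j z"

lemma shell_nonneg: "0 < r \<Longrightarrow> r \<le> 1 \<Longrightarrow> 0 \<le> shell r j z"
proof (cases "(norm z)\<^sup>2 \<le> 3 * real (Suc j)")
  case True
  then show ?thesis using cutoff_inner[of "Suc j" z r] cutoff_bounds[of r j z] by (simp add: shell_def)
next
  case False
  assume "0 < r" "r \<le> 1"
  then have "cutoff r j z = 0" using False by (intro cutoff_outer) auto
  then show ?thesis using cutoff_bounds[of r "Suc j" z] by (simp add: shell_def)
qed

lemma shell_eq_0_near: "0 < r \<Longrightarrow> r \<le> 1 \<Longrightarrow> norm z \<le> r / 2 \<Longrightarrow> shell r j z = 0"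
proof -
  assume r: "0 < r" "r \<le> 1" and z: "norm z \<le> r / 2"
  have "norm z \<le> 1" using r z by simp
  then have n: "(norm z)\<^sup>2 \<le> 1" by (simp add: power_le_one)
  have "cutoff r j z = 1" for j
    by (cases "j = 0") (use cutoff_0_inner[OF r(1) z] n cutoff_inner[of j z r] in auto)
  then show ?thesis by (simp add: shell_def)
qed

lemma shell_eq_0_inner: "(norm z)\<^sup>2 \<le> 3 * real j \<Longrightarrow> 0 < j \<Longrightarrow> shell r j z = 0"
  using cutoff_inner[of j z r] cutoff_inner[of "Suc j" z r] by (simp add: shell_def)

lemma shell_eq_0_outer: "0 < r \<Longrightarrow> r \<le> 1 \<Longrightarrow> 3 * real j + 6 \<le> (norm z)\<^sup>2 \<Longrightarrow> shell r j z = 0"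
  using cutoff_outer[of r j z] cutoff_outer[of r "Suc j" z] by (simp add: shell_def)

lemma sum_shell: "(\<Sum>j<n. shell r j z) = cutoff r n z - cutoff r 0 z"
  unfolding shell_def by (rule sum_lessThan_telescope)

lemma continuous_on_cutoff: "continuous_on S (cutoff r j)"
proof -
  have k: "continuous_on UNIV smoothstep"
    unfolding smoothstep_def[abs_def] by (intro continuous_intros) auto
  have "continuous_on S (\<lambda>z. c * (norm z)\<^sup>2 - b)" for c b
    by (intro continuous_intros)
  then have "continuous_on S (\<lambda>z. 1 - smoothstep (c * (norm z)\<^sup>2 - b))" for c b
    by (rule continuous_on_diff[OF continuous_on_const continuous_on_compose2[OF k _ subset_UNIV]])
  from this[of "if j = 0 then 4 / r\<^sup>2 else 1" "if j = 0 then 1 else 3 * real j"]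
  show ?thesis by (cases "j = 0") (simp_all add: cutoff_def[abs_def])
qed

lemma continuous_on_shell: "continuous_on S (shell r j)"
  unfolding shell_def[abs_def] by (intro continuous_on_diff continuous_on_cutoff)

section \<open>Quadratic functions and Levy measures\<close>

lemma quad_add_scaled_identity: "quad (X + c *\<^sub>R mat 1) z = quad X z + c * (norm z)\<^sup>2"
  by (simp add: quad_def matrix_vector_mult_add_rdistrib scaleR_matrix_vector_assoc[symmetric]
      inner_add_left power2_norm_eq_inner)

lemma sym_matrices_add_scaled_identity: "X \<in> sym_matrices \<Longrightarrow> X + c *\<^sub>R mat 1 \<in> sym_matrices"
  unfolding sym_matrices_def by (simp add: vec_eq_iff transpose_def mat_def)

lemma quad_bound:
  fixes X :: "real^'n^'n"
  obtains C where "0 \<le> C" "\<And>z. \<bar>quad X z\<bar> \<le> C * (norm z)\<^sup>2"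
proof
  let ?C = "onorm ((*v) X)"
  show "0 \<le> ?C" by (simp add: onorm_pos_le)
  fix z
  have "\<bar>quad X z\<bar> \<le> norm (X *v z) * norm z"
    unfolding quad_def by (rule Cauchy_Schwarz_ineq2)
  also have "\<dots> \<le> (?C * norm z) * norm z"
    by (intro mult_right_mono onorm) auto
  finally show "\<bar>quad X z\<bar> \<le> ?C * (norm z)\<^sup>2" by (simp add: power2_eq_square)
qed

lemma continuous_on_quad: "continuous_on S (quad X)"
  unfolding quad_def by (intro continuous_intros)

lemma has_derivative_affine:
  fixes X :: "real^'n^'n"
  shows "((\<lambda>y. p + X *v (y - x)) has_derivative (*v) X) (at y)"
proof -
  have "((\<lambda>y. X *v (y - x)) has_derivative (*v) X) (at y)"
    by (rule bounded_linear.has_derivative[OF matrix_vector_mul_bounded_linear])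
      (auto intro!: derivative_eq_intros)
  then show ?thesis by (auto intro!: derivative_eq_intros)
qed

lemma GDERIV_quadratic:
  assumes "X \<in> sym_matrices"
  shows "GDERIV (\<lambda>y. a + p \<bullet> (y - x) + 1/2 * quad X (y - x)) y :> p + X *v (y - x)"
proof -
  have sym: "(X *v w) \<bullet> v = w \<bullet> (X *v v)" for v w
    using assms unfolding sym_matrices_def
    by (metis (mono_tags) dot_lmul_matrix mem_Collect_eq transpose_matrix_vector)
  have "((\<lambda>y. a + p \<bullet> (y - x) + 1/2 * ((X *v (y - x)) \<bullet> (y - x))) has_derivative
      (\<lambda>h. p \<bullet> h + 1/2 * ((X *v (y - x)) \<bullet> h + (X *v h) \<bullet> (y - x)))) (at y)"
    using has_derivative_affine[of 0 X x y] by (auto intro!: derivative_eq_intros)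
  moreover have "(\<lambda>h. p \<bullet> h + 1/2 * ((X *v (y - x)) \<bullet> h + (X *v h) \<bullet> (y - x)))
      = (\<lambda>h. h \<bullet> (p + X *v (y - x)))"
  proof
    fix h
    show "p \<bullet> h + 1/2 * ((X *v (y - x)) \<bullet> h + (X *v h) \<bullet> (y - x)) = h \<bullet> (p + X *v (y - x))"
      using sym[of h "y - x"] inner_commute[of "X *v (y - x)" h] inner_commute[of p h]
      by (simp add: inner_add_right)
  qed
  ultimately show ?thesis by (simp add: gderiv_def quad_def)
qed

lemma C2_on_quadratic:
  assumes "X \<in> sym_matrices" "open S"
  shows "C2_on S (\<lambda>y. a + p \<bullet> (y - x) + 1/2 * quad X (y - x))"
  by (rule C2_onI[OF assms(2) GDERIV_quadratic[OF assms(1)] has_derivative_affine]) simp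

lemma levy_integrable_square:
  assumes "levy_measure q"
  shows "integrable q (\<lambda>z. indicator {z. norm z < 1} z * (norm z)\<^sup>2)"
proof (rule integrableI_bounded)
  have q: "sets q = sets borel" using assms by (simp add: levy_measure_def)
  show "(\<lambda>z. indicator {z. norm z < 1} z * (norm z)\<^sup>2) \<in> borel_measurable q"
    unfolding measurable_cong_sets[OF q refl] by measurable
  have "(\<integral>\<^sup>+z. ennreal (norm (indicator {z. norm z < 1} z * (norm z)\<^sup>2)) \<partial>q)
      = (\<integral>\<^sup>+z\<in>{z. norm z < 1}. ennreal ((norm z)\<^sup>2) \<partial>q)"
    by (intro nn_integral_cong) (auto simp: indicator_def)
  also have "\<dots> < \<infinity>" using assms by (auto simp: levy_measure_def)
  finally show "(\<integral>\<^sup>+z. ennreal (norm (indicator {z. norm z < 1} z * (norm z)\<^sup>2)) \<partial>q) < \<infinity>" .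
qed

lemma levy_finite_outside:
  fixes q :: "(real^'n) measure"
  assumes "levy_measure q" "0 < a"
  shows "emeasure q {z. a \<le> norm z} < \<infinity>"
proof -
  have q: "sets q = sets borel" using assms by (simp add: levy_measure_def)
  let ?I = "\<integral>\<^sup>+z\<in>{z. norm z < 1}. ennreal ((norm z)\<^sup>2) \<partial>q"
  \<comment> \<open>On \<open>a \<le> \<bar>z\<bar> < 1\<close> the indicator is at most \<open>\<bar>z\<bar>\<^sup>2 / a\<^sup>2\<close>.\<close>
  have fin: "?I < \<infinity>" "emeasure q {z. 1 \<le> norm z} < \<infinity>"
    using assms by (auto simp: levy_measure_def)
  have meas[measurable]: "{z. a \<le> norm z} \<in> sets q" "{z. 1 \<le> norm z} \<in> sets q" "{z. norm z < 1} \<in> sets q"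
    unfolding q by measurable
  have meas2[measurable]: "(\<lambda>z. ennreal ((norm z)\<^sup>2)) \<in> borel_measurable q"
    unfolding measurable_cong_sets[OF q refl] by measurable
  have "emeasure q {z. a \<le> norm z} = (\<integral>\<^sup>+z. indicator {z. a \<le> norm z} z \<partial>q)"
    by simp
  also have "\<dots> \<le> (\<integral>\<^sup>+z. ennreal (1 / a\<^sup>2) * (ennreal ((norm z)\<^sup>2) * indicator {z. norm z < 1} z)
      + indicator {z. 1 \<le> norm z} z \<partial>q)"
  proof (rule nn_integral_mono)
    fix z :: "real^'n"
    have "1 \<le> ennreal (1 / a\<^sup>2) * ennreal ((norm z)\<^sup>2)" if "a \<le> norm z"
    proof -
      have "a\<^sup>2 \<le> (norm z)\<^sup>2" using that assms(2) by (intro power_mono) auto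
      then show ?thesis
        using assms(2) by (simp add: ennreal_mult[symmetric] field_simps flip: ennreal_1)
    qed
    then show "indicator {z. a \<le> norm z} z \<le> ennreal (1 / a\<^sup>2) * (ennreal ((norm z)\<^sup>2) * indicator {z. norm z < 1} z)
      + indicator {z. 1 \<le> norm z} z"
      by (auto simp: indicator_def)
  qed
  also have "\<dots> = ennreal (1 / a\<^sup>2) * ?I + emeasure q {z. 1 \<le> norm z}"
    by (subst nn_integral_add) (auto simp: nn_integral_cmult)
  also have "\<dots> < \<infinity>" using fin by (simp add: ennreal_mult_less_top)
  finally show ?thesis .
qed

section \<open>Test functions\<close>

text \<open>The test function interpolates between the quadratic function near \<open>x\<close> and \<open>max u (-M)\<close>
  away from \<open>x\<close>, up to an excess \<open>E\<close> with small integral. On the \<open>j\<close>-th shell the excess is that of a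
  polynomial majorant and contributes at most \<open>e / 2^(j+1)\<close>. The truncation at \<open>-M\<close> is needed because \<open>u\<close>
  may fail to be bounded below, or even integrable, on a shell.\<close>

lemma test_function:
  fixes u :: "real^'n \<Rightarrow> real"
  assumes u: "usc u" and X: "X \<in> sym_matrices" and q: "levy_measure q" and r: "0 < r" "r \<le> 1"
    and exp: "upper_expansion u x p X r \<eta>" and e: "0 < e"
  obtains \<phi> E where "C2 \<phi>" "touches_above \<phi> u x" "grad \<phi> x = p" "hess \<phi> x = X + (2 * \<eta>) *\<^sub>R mat 1"
    "integrable q E" "(LINT z|q. E z) \<le> e"
    "\<And>z. \<phi> (x + z) = cutoff r 0 z * (u x + p \<bullet> z + 1/2 * quad X z + \<eta> * (norm z)\<^sup>2)
       + (1 - cutoff r 0 z) * max (u (x + z)) (- M) + E z"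
proof -
  define w where "w z = max (u (x + z)) (- M)" for z
  \<comment> \<open>A compact set on which the Levy measure is finite and outside of which \<open>shell r j\<close> vanishes.\<close>
  define K where "K j = {z :: real^'n. r / 2 \<le> norm z} \<inter> cball 0 (sqrt (3 * real j + 6))" for j
  \<comment> \<open>The factor \<open>2\<close> comes from the \<open>1/2\<close> in front of the quadratic form.\<close>
  define Y where "Y = X + (2 * \<eta>) *\<^sub>R mat 1"
  define T where "T y = u x + p \<bullet> (y - x) + 1/2 * quad Y (y - x)" for y
  have sq: "sets q = sets borel" using q by (simp add: levy_measure_def)
  have w: "usc w" unfolding w_def by (intro usc_max_const usc_translate u)
  have Y: "Y \<in> sym_matrices" unfolding Y_def by (rule sym_matrices_add_scaled_identity[OF X])
  have T: "T (x + z) = u x + p \<bullet> z + 1/2 * quad X z + \<eta> * (norm z)\<^sup>2" for z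
    by (simp add: T_def Y_def quad_add_scaled_identity field_simps)
  have cl: "closed {z :: real^'n. r / 2 \<le> norm z}"
    by (intro closed_Collect_le continuous_intros)
  have Kc: "compact (K j)" for j
    unfolding K_def by (rule closed_Int_compact[OF cl compact_cball])
  have Kfin: "emeasure q (K j) < \<infinity>" for j
  proof -
    have "emeasure q (K j) \<le> emeasure q {z. r / 2 \<le> norm z}"
      using cl by (intro emeasure_mono) (auto simp: K_def sq)
    also have "\<dots> < \<infinity>" using r by (intro levy_finite_outside[OF q]) simp
    finally show ?thesis .
  qed
  have "\<forall>j. \<exists>P. real_polynomial_function P \<and> (\<forall>z\<in>K j. w z \<le> P z) \<and>
      (\<integral>\<^sup>+z\<in>K j. ennreal (P z - w z) \<partial>q) \<le> ennreal (e * (1/2) ^ Suc j)"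
  proof
    fix j
    obtain P where "real_polynomial_function P" "\<And>z. z \<in> K j \<Longrightarrow> w z \<le> P z"
      "(\<integral>\<^sup>+z\<in>K j. ennreal (P z - w z) \<partial>q) \<le> ennreal (e * (1/2) ^ Suc j)"
    proof (rule usc_polynomial_majorant[OF Kc w _ sq Kfin])
      show "- M \<le> w z" for z by (simp add: w_def)
      show "0 < e * (1/2) ^ Suc j" using e by simp
    qed blast
    then show "\<exists>P. real_polynomial_function P \<and> (\<forall>z\<in>K j. w z \<le> P z) \<and>
      (\<integral>\<^sup>+z\<in>K j. ennreal (P z - w z) \<partial>q) \<le> ennreal (e * (1/2) ^ Suc j)" by blast
  qed
  then obtain P where P': "\<forall>j. real_polynomial_function (P j) \<and> (\<forall>z\<in>K j. w z \<le> P j z) \<and>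
      (\<integral>\<^sup>+z\<in>K j. ennreal (P j z - w z) \<partial>q) \<le> ennreal (e * (1/2) ^ Suc j)"
    by (rule choice[THEN exE])
  have P: "\<And>j. real_polynomial_function (P j)" "\<And>j z. z \<in> K j \<Longrightarrow> w z \<le> P j z"
    "\<And>j. (\<integral>\<^sup>+z\<in>K j. ennreal (P j z - w z) \<partial>q) \<le> ennreal (e * (1/2) ^ Suc j)"
    using P' by simp_all
  have shell_K: "z \<in> K j" if "shell r j z \<noteq> 0" for j z
  proof -
    have "r / 2 < norm z" using shell_eq_0_near[OF r, of z j] that by force
    moreover have "(norm z)\<^sup>2 < 3 * real j + 6" using shell_eq_0_outer[OF r, of j z] that by force
    then have "norm z \<le> sqrt (3 * real j + 6)" by (intro real_le_rsqrt) simp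
    ultimately show ?thesis by (simp add: K_def)
  qed
  define \<Phi> where "\<Phi> z = cutoff r 0 z * T (x + z) + (\<Sum>j. shell r j z * P j z)" for z
  define E where "E z = (\<Sum>j. shell r j z * (P j z - w z))" for z
  \<comment> \<open>The sums over the shells are locally finite.\<close>
  have vanish: "shell r j z = 0" if "(norm z)\<^sup>2 \<le> 3 * real N" "0 < N" "N \<le> j" for j N z
    using shell_eq_0_inner[of z j r] that by simp
  have sum1: "(\<Sum>j. shell r j z * f j) = (\<Sum>j<N. shell r j z * f j)"
    if "(norm z)\<^sup>2 \<le> 3 * real N" "0 < N" for N z f
    by (rule suminf_finite) (use vanish[OF that] in auto)
  have summ: "summable (\<lambda>j. shell r j z * f j)" for z f
  proof -
    obtain N :: nat where N: "(norm z)\<^sup>2 < real N" using reals_Archimedean2 by blast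
    show ?thesis
      by (rule summable_finite[of "{..<Suc N}"]) (use vanish[of z "Suc N"] N in auto)
  qed
  have term_nonneg: "0 \<le> shell r j z * (P j z - w z)" for j z
    using shell_nonneg[OF r, of j z] P(2)[OF shell_K[of j z]] by (cases "shell r j z = 0") auto
  have E_nonneg: "0 \<le> E z" for z
    unfolding E_def by (rule suminf_nonneg[OF summ term_nonneg])
  have \<Phi>_E: "\<Phi> z = cutoff r 0 z * T (x + z) + (1 - cutoff r 0 z) * w z + E z" for z
  proof -
    obtain N :: nat where N: "(norm z)\<^sup>2 < real N" using reals_Archimedean2 by blast
    have N': "(norm z)\<^sup>2 \<le> 3 * real (Suc N)" using N by simp
    have "(\<Sum>j<Suc N. shell r j z) = 1 - cutoff r 0 z"
      unfolding sum_shell using cutoff_inner[OF _ N'] by simp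
    moreover have "E z = (\<Sum>j<Suc N. shell r j z * P j z) - (\<Sum>j<Suc N. shell r j z) * w z"
      unfolding E_def sum1[OF N' zero_less_Suc]
      by (simp only: right_diff_distrib sum_subtractf sum_distrib_right)
    ultimately have "E z = (\<Sum>j<Suc N. shell r j z * P j z) - (1 - cutoff r 0 z) * w z"
      by simp
    then show ?thesis
      unfolding \<Phi>_def sum1[OF N' zero_less_Suc] by simp
  qed
  define \<phi> where "\<phi> y = \<Phi> (y - x)" for y
  have C2\<phi>: "C2 \<phi>"
  proof (rule C2_locally)
    fix y
    obtain N :: nat where N: "(norm (y - x))\<^sup>2 < real N" using reals_Archimedean2 by blast
    define S where "S = {z :: real^'n. (norm z)\<^sup>2 < 3 * real (Suc N)}"
    have S: "open S" unfolding S_def by (intro open_Collect_less continuous_intros)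
    have sh: "C2_on S (shell r j)" for j
      using C2_on_add[OF C2_on_cutoff[OF S, of r "Suc j"]
          C2_on_mult[OF C2_on_const[OF S, of "-1"] C2_on_cutoff[OF S, of r j]]]
      by (simp add: shell_def[abs_def])
    have "C2_on S (\<lambda>z. \<Sum>j<Suc N. shell r j z * P j z)"
      by (intro C2_on_sum S C2_on_mult sh C2_on_polynomial P(1)) simp
    then have "C2_on S (\<lambda>z. cutoff r 0 z * (u x + p \<bullet> (z - 0) + 1/2 * quad Y (z - 0))
        + (\<Sum>j<Suc N. shell r j z * P j z))"
      by (intro C2_on_add[OF C2_on_mult[OF C2_on_cutoff[OF S] C2_on_quadratic[OF Y S]]])
    then have "C2_on S \<Phi>"
      by (rule C2_on_cong) (simp add: \<Phi>_def T_def sum1[of _ "Suc N"] S_def)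
    then have "C2_on ((+) x ` S) \<phi>"
      unfolding \<phi>_def[abs_def] by (rule C2_on_translate)
    moreover have "y \<in> (+) x ` S"
      using N by (intro image_eqI[of _ _ "y - x"]) (auto simp: S_def)
    ultimately show "\<exists>S. y \<in> S \<and> C2_on S \<phi>" by blast
  qed
  have near: "\<phi> y = T y" if "y \<in> ball x (r / 2)" for y
  proof -
    have n: "norm (y - x) \<le> r / 2" using that by (simp add: dist_norm norm_minus_commute)
    show ?thesis
      by (simp add: \<phi>_def \<Phi>_def cutoff_0_inner[OF r(1) n] shell_eq_0_near[OF r n])
  qed
  have x: "x \<in> ball x (r / 2)" using r by simp
  have gr: "GDERIV \<phi> y :> p + Y *v (y - x)" if "y \<in> ball x (r / 2)" for y
    using GDERIV_quadratic[OF Y] open_ball that by (rule GDERIV_transform_within_open) (simp add: near T_def)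
  have grad: "grad \<phi> x = p" using grad_eq[OF gr[OF x]] by simp
  have hess: "hess \<phi> x = Y"
    using hess_eq[OF has_derivative_grad_on[OF open_ball gr has_derivative_affine x]] by (simp add: matrix_of_matrix_vector_mul)
  have touch: "touches_above \<phi> u x"
  proof -
    have "u (x + z) \<le> \<Phi> z" for z
    proof -
      have "u (x + z) \<le> T (x + z)" if "cutoff r 0 z \<noteq> 0"
      proof -
        have "norm z \<le> r" using cutoff_0_outer[OF r(1), of z] that by force
        then show ?thesis using exp unfolding T upper_expansion_def by fastforce
      qed
      then have "cutoff r 0 z * u (x + z) \<le> cutoff r 0 z * T (x + z)"
        using cutoff_bounds[of r 0 z] by (cases "cutoff r 0 z = 0") auto
      moreover have "(1 - cutoff r 0 z) * u (x + z) \<le> (1 - cutoff r 0 z) * w z"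
        using cutoff_bounds[of r 0 z] by (intro mult_left_mono) (auto simp: w_def)
      ultimately show ?thesis
        using E_nonneg[of z] unfolding \<Phi>_E by (simp add: algebra_simps)
    qed
    from this[of "y - x" for y] have "u y \<le> \<phi> y" for y by (simp add: \<phi>_def)
    moreover have "\<phi> x = u x" using near[OF x] by (simp add: T_def quad_def)
    ultimately show ?thesis by (simp add: touches_above_def)
  qed
  have mw: "w \<in> borel_measurable q"
    using usc_borel_measurable[OF w] by (simp add: measurable_cong_sets[OF sq refl])
  have mP: "P j \<in> borel_measurable q" for j
    unfolding measurable_cong_sets[OF sq refl]
    by (intro borel_measurable_continuous_onI continuous_on_polymonial_function)
      (simp add: real_polynomial_function_eq[symmetric] P(1))
  have mshell: "shell r j \<in> borel_measurable q" for j
    unfolding measurable_cong_sets[OF sq refl]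
    by (intro borel_measurable_continuous_onI continuous_on_shell)
  have mterm: "(\<lambda>z. shell r j z * (P j z - w z)) \<in> borel_measurable q" for j
    using mw mP mshell by measurable
  have mE: "E \<in> borel_measurable q"
    unfolding E_def[abs_def] using mterm by (rule borel_measurable_suminf)
  have "(\<integral>\<^sup>+z. ennreal (E z) \<partial>q) = (\<integral>\<^sup>+z. (\<Sum>j. ennreal (shell r j z * (P j z - w z))) \<partial>q)"
    unfolding E_def by (simp add: suminf_ennreal2[OF term_nonneg summ])
  also have "\<dots> = (\<Sum>j. \<integral>\<^sup>+z. ennreal (shell r j z * (P j z - w z)) \<partial>q)"
    by (rule nn_integral_suminf) (use mterm in measurable)
  also have "\<dots> \<le> (\<Sum>j. ennreal (e * (1/2) ^ Suc j))"
  proof (rule suminf_le)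
    fix j
    have "(\<integral>\<^sup>+z. ennreal (shell r j z * (P j z - w z)) \<partial>q) \<le> (\<integral>\<^sup>+z\<in>K j. ennreal (P j z - w z) \<partial>q)"
    proof (rule nn_integral_mono)
      fix z
      show "ennreal (shell r j z * (P j z - w z)) \<le> ennreal (P j z - w z) * indicator (K j) z"
      proof (cases "shell r j z = 0")
        case False
        have "shell r j z \<le> 1"
          using cutoff_bounds(1)[of r j z] cutoff_bounds(2)[of r "Suc j" z] by (simp add: shell_def)
        then have "shell r j z * (P j z - w z) \<le> P j z - w z"
          using P(2)[OF shell_K[OF False]] shell_nonneg[OF r, of j z]
          by (intro mult_left_le_one_le) auto
        then show ?thesis using shell_K[OF False] by (simp add: ennreal_leI)
      qed simp
    qed
    also note P(3)
    finally show "(\<integral>\<^sup>+z. ennreal (shell r j z * (P j z - w z)) \<partial>q) \<le> ennreal (e * (1/2) ^ Suc j)" .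
  qed auto
  also have "\<dots> = ennreal e"
  proof -
    have s: "(\<lambda>j. e * (1/2) ^ Suc j) sums (e * 1)"
      by (intro sums_mult power_half_series)
    have "(\<Sum>j. ennreal (e * (1/2) ^ Suc j)) = ennreal (\<Sum>j. e * (1/2) ^ Suc j)"
      by (rule suminf_ennreal2[OF _ sums_summable[OF s]]) (use e in simp)
    then show ?thesis by (simp only: sums_unique[OF s, symmetric] mult_1_right)
  qed
  finally have Ele: "(\<integral>\<^sup>+z. ennreal (E z) \<partial>q) \<le> ennreal e" .
  have "(\<integral>\<^sup>+z. ennreal (E z) \<partial>q) < \<infinity>"
    using le_less_trans[OF Ele ennreal_less_top] by (simp only: infinity_ennreal_def)
  then have Eint: "integrable q E"
    by (rule integrableI_nonneg[OF mE AE_I2[OF E_nonneg]])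
  have "ennreal (LINT z|q. E z) \<le> ennreal e"
    using Ele unfolding nn_integral_eq_integral[OF Eint AE_I2[OF E_nonneg]] .
  then have E_le: "(LINT z|q. E z) \<le> e" using e by (simp only: ennreal_le_iff less_imp_le)
  have formula: "\<phi> (x + z) = cutoff r 0 z * (u x + p \<bullet> z + 1/2 * quad X z + \<eta> * (norm z)\<^sup>2)
       + (1 - cutoff r 0 z) * max (u (x + z)) (- M) + E z" for z
    using \<Phi>_E[of z] unfolding \<phi>_def T w_def by (simp only: add_diff_cancel_left')
  show ?thesis
    by (rule that[OF C2\<phi> touch grad hess[unfolded Y_def] Eint E_le formula])
qed

section \<open>Integrals with values in the extended reals\<close>

lemma ext_integral_eq_integral:
  assumes "integrable M f"
  shows "ext_integral M f = ereal (LINT z|M. f z)"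
proof -
  obtain a where a: "0 \<le> a" "(\<integral>\<^sup>+z. ennreal (f z) \<partial>M) = ennreal a"
    using assms unfolding real_integrable_def by (metis ennreal_cases infinity_ennreal_def)
  obtain b where b: "0 \<le> b" "(\<integral>\<^sup>+z. ennreal (- f z) \<partial>M) = ennreal b"
    using assms unfolding real_integrable_def by (metis ennreal_cases infinity_ennreal_def)
  show ?thesis
    using a b real_lebesgue_integral_def[OF assms] by (simp add: ext_integral_def enn2ereal_ennreal)
qed

lemma integrable_if_ext_integral_finite:
  assumes "f \<in> borel_measurable M" "(\<integral>\<^sup>+z. ennreal (f z) \<partial>M) < \<infinity>" "ext_integral M f \<noteq> - \<infinity>"
  shows "integrable M f"
proof -
  have "(\<integral>\<^sup>+z. ennreal (- f z) \<partial>M) \<noteq> \<infinity>"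
  proof
    assume "(\<integral>\<^sup>+z. ennreal (- f z) \<partial>M) = \<infinity>"
    with assms(2,3) show False
      unfolding ext_integral_def by (cases "\<integral>\<^sup>+z. ennreal (f z) \<partial>M") (simp_all add: enn2ereal_ennreal)
  qed
  with assms(1,2) show ?thesis unfolding real_integrable_def by simp
qed

lemma integrable_imp_has_ext_integral:
  assumes "integrable M f" shows "has_ext_integral M f"
  using assms unfolding real_integrable_def has_ext_integral_def
  by (simp add: less_top)

lemma ext_integral_mono:
  assumes "\<And>z. f z \<le> g z" shows "ext_integral M f \<le> ext_integral M g"
proof -
  have "(\<integral>\<^sup>+z. ennreal (f z) \<partial>M) \<le> (\<integral>\<^sup>+z. ennreal (g z) \<partial>M)"
    by (intro nn_integral_mono ennreal_leI assms)
  moreover have "(\<integral>\<^sup>+z. ennreal (- g z) \<partial>M) \<le> (\<integral>\<^sup>+z. ennreal (- f z) \<partial>M)"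
    by (intro nn_integral_mono ennreal_leI le_imp_neg_le assms)
  ultimately show ?thesis
    unfolding ext_integral_def less_eq_ennreal.rep_eq by (rule ereal_minus_mono)
qed

text \<open>Without the assumption this fails, because \<open>\<infinity> - \<infinity> = \<infinity>\<close> in the extended reals.\<close>

lemma ext_integral_uminus:
  assumes "has_ext_integral M f" shows "ext_integral M (\<lambda>z. - f z) = - ext_integral M f"
proof -
  have "enn2ereal b - enn2ereal a = - (enn2ereal a - enn2ereal b)"
    if "a < \<infinity> \<or> b < \<infinity>" for a b
    using that by (cases a; cases b) (simp_all add: enn2ereal_ennreal)
  then show ?thesis
    using assms by (simp add: ext_integral_def has_ext_integral_def)
qed

text \<open>The reverse Fatou lemma in the form in which the limits of test functions use it: the lower
  bounds on the integrals force the limit to be integrable.\<close>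

lemma reverse_Fatou:
  fixes g :: "nat \<Rightarrow> 'a \<Rightarrow> real"
  assumes h: "h \<in> borel_measurable M" and g: "\<And>n. integrable M (g n)" and G: "integrable M G"
    and le: "\<And>n z. g n z \<le> G z" and lim: "\<And>z. (\<lambda>n. g n z) \<longlonglongrightarrow> h z"
    and a: "\<And>n. a n \<le> (LINT z|M. g n z)" "a \<longlonglongrightarrow> l"
  shows "integrable M h \<and> l \<le> (LINT z|M. h z)"
proof -
  have hG: "h z \<le> G z" for z
    by (rule LIMSEQ_le_const2[OF lim]) (use le in auto)
  have "(\<integral>\<^sup>+z. ennreal (G z - h z) \<partial>M) = (\<integral>\<^sup>+z. liminf (\<lambda>n. ennreal (G z - g n z)) \<partial>M)"
  proof (rule nn_integral_cong)
    fix z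
    have "(\<lambda>n. ennreal (G z - g n z)) \<longlonglongrightarrow> ennreal (G z - h z)"
      by (intro tendsto_ennrealI tendsto_diff tendsto_const lim)
    then show "ennreal (G z - h z) = liminf (\<lambda>n. ennreal (G z - g n z))"
      by (simp add: lim_imp_Liminf)
  qed
  also have "\<dots> \<le> liminf (\<lambda>n. \<integral>\<^sup>+z. ennreal (G z - g n z) \<partial>M)"
    by (rule nn_integral_liminf) (use g G in measurable)
  also have "\<dots> \<le> liminf (\<lambda>n. ennreal ((LINT z|M. G z) - a n))"
  proof (rule Liminf_mono, rule always_eventually, rule allI)
    fix n
    have "(\<integral>\<^sup>+z. ennreal (G z - g n z) \<partial>M) = ennreal (LINT z|M. G z - g n z)"
      by (rule nn_integral_eq_integral) (use g G le in auto)
    also have "(LINT z|M. G z - g n z) \<le> (LINT z|M. G z) - a n"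
      using a(1)[of n] g G by simp
    finally show "(\<integral>\<^sup>+z. ennreal (G z - g n z) \<partial>M) \<le> ennreal ((LINT z|M. G z) - a n)"
      by (simp add: ennreal_leI)
  qed
  also have "\<dots> = ennreal ((LINT z|M. G z) - l)"
    by (intro lim_imp_Liminf tendsto_ennrealI tendsto_diff tendsto_const a(2)) simp
  finally have bd: "(\<integral>\<^sup>+z. ennreal (G z - h z) \<partial>M) \<le> ennreal ((LINT z|M. G z) - l)" .
  have fin: "(\<integral>\<^sup>+z. ennreal (G z - h z) \<partial>M) < \<infinity>"
    using le_less_trans[OF bd ennreal_less_top] by (simp only: infinity_ennreal_def)
  have int: "integrable M (\<lambda>z. G z - h z)"
    by (rule integrableI_nonneg[OF _ _ fin]) (use h G hG in auto)
  then have inth: "integrable M h"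
    using Bochner_Integration.integrable_diff[OF G int] by simp
  have "0 \<le> (LINT z|M. G z) - a n" for n
    using a(1)[of n] integral_mono[OF g G le] by (meson diff_ge_0_iff_ge order_trans)
  then have "0 \<le> (LINT z|M. G z) - l"
    using LIMSEQ_le_const[OF tendsto_diff[OF tendsto_const a(2)]] by blast
  moreover have "ennreal (LINT z|M. G z - h z) \<le> ennreal ((LINT z|M. G z) - l)"
    using bd nn_integral_eq_integral[OF int] hG by simp
  ultimately have "(LINT z|M. G z - h z) \<le> (LINT z|M. G z) - l"
    by (simp only: ennreal_le_iff)
  then show ?thesis using inth G by simp
qed

section \<open>Integrability of Levy increments\<close>

lemma borel_measurable_shift:
  assumes "u \<in> borel_measurable borel" "sets q = sets borel"
  shows "(\<lambda>z :: real^'n. u (x + z)) \<in> borel_measurable q"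
  unfolding measurable_cong_sets[OF assms(2) refl]
  by (rule measurable_compose[OF _ assms(1)]) simp

lemma levy_increment_measurable:
  assumes "u \<in> borel_measurable borel" "sets q = sets borel"
  shows "levy_increment u x p \<in> borel_measurable q"
proof -
  have 1: "(\<lambda>z. indicator {z. norm z \<le> 1} z * (z \<bullet> p)) \<in> borel_measurable q"
    unfolding measurable_cong_sets[OF assms(2) refl] by measurable
  show ?thesis
    unfolding levy_increment_def[abs_def]
    by (intro borel_measurable_diff borel_measurable_shift[OF assms] borel_measurable_const 1)
qed

text \<open>The common upper bound for the Levy increments of \<open>u\<close> and of its approximations: quadratic in
  the ball of radius \<open>r\<close>, where the superjet inequality controls them, and \<open>u\<^sup>+\<close> plus a constant outside.\<close>

definition dominant :: "real \<Rightarrow> real \<Rightarrow> (real^'n \<Rightarrow> real) \<Rightarrow> real^'n \<Rightarrow> real^'n \<Rightarrow> real^'n \<Rightarrow> real" where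
  "dominant C r u x p z =
     (if norm z < r then C * (norm z)\<^sup>2 else max (u (x + z)) 0 + \<bar>u x\<bar> + norm p)"

lemma dominant_nonneg: "0 \<le> C \<Longrightarrow> 0 \<le> dominant C r u x p z"
  by (simp add: dominant_def)

lemma integrable_indicator_outside:
  assumes "levy_measure q" "0 < a"
  shows "integrable q (\<lambda>z. indicator {z. a \<le> norm z} z * (c :: real))"
proof -
  have q: "sets q = sets borel" using assms by (simp add: levy_measure_def)
  have "{z. a \<le> norm z} \<in> sets q" unfolding q by measurable
  then show ?thesis
    using levy_finite_outside[OF assms] by (intro integrable_mult_left integrable_real_indicator)
qed

lemma integrable_dominant:
  fixes u :: "real^'n \<Rightarrow> real"
  assumes q: "levy_measure q" and u: "usc u" and r: "0 < r" "r \<le> 1" and C: "0 \<le> C"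
    and tail: "(\<integral>\<^sup>+z\<in>{z. 1 \<le> norm z}. ennreal (u (x + z)) \<partial>q) < \<infinity>"
  shows "integrable q (dominant C r u x p)"
proof -
  have sq: "sets q = sets borel" using q by (simp add: levy_measure_def)
  have mu: "(\<lambda>z. u (x + z)) \<in> borel_measurable q"
    by (rule borel_measurable_shift[OF usc_borel_measurable[OF u] sq])
  have ind[measurable]: "{z. r \<le> norm z} \<in> sets q" "{z. 1 \<le> norm z} \<in> sets q" "{z. norm z < r} \<in> sets q"
    unfolding sq by measurable
  obtain B where B: "\<And>z. z \<in> cball 0 1 \<Longrightarrow> u (x + z) \<le> B"
    using usc_bounded_above_on_compact[OF usc_translate[OF u] compact_cball] by blast
  have pos: "integrable q (\<lambda>z. indicator {z. r \<le> norm z} z * max (u (x + z)) 0)"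
  proof (rule integrableI_nonneg)
    show "(\<lambda>z. indicator {z. r \<le> norm z} z * max (u (x + z)) 0) \<in> borel_measurable q"
      using mu by measurable
    have "(\<integral>\<^sup>+z. ennreal (indicator {z. r \<le> norm z} z * max (u (x + z)) 0) \<partial>q)
        \<le> (\<integral>\<^sup>+z. ennreal (u (x + z)) * indicator {z. 1 \<le> norm z} z
            + ennreal \<bar>B\<bar> * indicator {z. r \<le> norm z} z \<partial>q)"
    proof (rule nn_integral_mono)
      fix z
      show "ennreal (indicator {z. r \<le> norm z} z * max (u (x + z)) 0)
          \<le> ennreal (u (x + z)) * indicator {z. 1 \<le> norm z} z + ennreal \<bar>B\<bar> * indicator {z. r \<le> norm z} z"
      proof (cases "norm z < 1")
        case True
        then have "max (u (x + z)) 0 \<le> \<bar>B\<bar>" using B[of z] by auto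
        then show ?thesis using True by (auto simp: indicator_def intro!: ennreal_leI)
      next
        case False
        have "ennreal (max (u (x + z)) 0) \<le> ennreal (u (x + z))"
          by (cases "0 \<le> u (x + z)") (auto simp: max_def)
        then show ?thesis using False r by (auto simp: indicator_def add_increasing2)
      qed
    qed
    also have "\<dots> = (\<integral>\<^sup>+z\<in>{z. 1 \<le> norm z}. ennreal (u (x + z)) \<partial>q) + ennreal \<bar>B\<bar> * emeasure q {z. r \<le> norm z}"
      using mu by (subst nn_integral_add) (auto simp: nn_integral_cmult)
    also have "\<dots> < \<infinity>"
      using tail levy_finite_outside[OF q r(1)] by (simp add: ennreal_mult_less_top)
    finally show "(\<integral>\<^sup>+z. ennreal (indicator {z. r \<le> norm z} z * max (u (x + z)) 0) \<partial>q) < \<infinity>" .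
  qed (auto simp: indicator_def)
  have int: "integrable q (\<lambda>z. C * (indicator {z. norm z < 1} z * (norm z)\<^sup>2)
      + (indicator {z. r \<le> norm z} z * max (u (x + z)) 0
        + indicator {z. r \<le> norm z} z * (\<bar>u x\<bar> + norm p)))"
    by (intro Bochner_Integration.integrable_add integrable_mult_right levy_integrable_square q pos
        integrable_indicator_outside r)
  show ?thesis
  proof (rule Bochner_Integration.integrable_bound[OF int])
    have sqm: "(\<lambda>z :: real^'n. (norm z)\<^sup>2) \<in> borel_measurable q"
      unfolding measurable_cong_sets[OF sq refl] by measurable
    show "dominant C r u x p \<in> borel_measurable q"
      unfolding dominant_def[abs_def] using mu sqm ind(3)
      by (intro measurable_If) (auto simp: sets_eq_imp_space_eq[OF sq])
    show "AE z in q. norm (dominant C r u x p z) \<le> norm (C * (indicator {z. norm z < 1} z * (norm z)\<^sup>2)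
      + (indicator {z. r \<le> norm z} z * max (u (x + z)) 0
        + indicator {z. r \<le> norm z} z * (\<bar>u x\<bar> + norm p)))"
    proof (rule AE_I2)
      fix z
      have "dominant C r u x p z \<le> C * (indicator {z. norm z < 1} z * (norm z)\<^sup>2)
      + (indicator {z. r \<le> norm z} z * max (u (x + z)) 0
        + indicator {z. r \<le> norm z} z * (\<bar>u x\<bar> + norm p))"
        using r C by (auto simp: dominant_def indicator_def)
      then show "norm (dominant C r u x p z) \<le> norm (C * (indicator {z. norm z < 1} z * (norm z)\<^sup>2)
      + (indicator {z. r \<le> norm z} z * max (u (x + z)) 0
        + indicator {z. r \<le> norm z} z * (\<bar>u x\<bar> + norm p)))"
        using dominant_nonneg[OF C, of r u x p z] by simp
    qed
  qed
qed

lemma first_order_bound: "\<bar>indicator {z. norm z \<le> 1} z * (z \<bullet> p)\<bar> \<le> norm (p :: real^'n)"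
proof (cases "norm z \<le> 1")
  case True
  have "\<bar>z \<bullet> p\<bar> \<le> norm z * norm p" by (rule Cauchy_Schwarz_ineq2)
  also have "\<dots> \<le> 1 * norm p" using True by (intro mult_right_mono) auto
  finally show ?thesis using True by simp
qed simp

text \<open>Near the origin the first-order term of the expansion cancels against that of the increment,
  because \<open>r \<le> 1\<close>.\<close>

lemma levy_increment_le_dominant:
  assumes "upper_expansion u x p X r 1" "r \<le> 1" "\<bar>quad X z\<bar> \<le> C * (norm z)\<^sup>2" "0 \<le> C"
  shows "levy_increment u x p z \<le> dominant (C + 1) r u x p z"
proof (cases "norm z < r")
  case True
  have "u (x + z) - u x \<le> p \<bullet> z + 1/2 * quad X z + 1 * (norm z)\<^sup>2"
    using assms(1) True by (simp add: upper_expansion_def)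
  moreover have "0 \<le> C * (norm z)\<^sup>2" using assms(4) by simp
  ultimately show ?thesis
    using True assms(2,3) by (simp add: levy_increment_def dominant_def inner_commute distrib_right)
next
  case False
  then show ?thesis
    using first_order_bound[of z p] by (simp add: levy_increment_def dominant_def)
qed

lemma upper_expansion_mono:
  "upper_expansion u x p X \<epsilon> \<delta> \<Longrightarrow> \<epsilon>' \<le> \<epsilon> \<Longrightarrow> \<delta> \<le> \<delta>' \<Longrightarrow> upper_expansion u x p X \<epsilon>' \<delta>'"
  unfolding upper_expansion_def by (smt (verit) mult_right_mono zero_le_power2)

section \<open>Equivalence of the definitions for subsolutions\<close>

text \<open>The common reformulation: the inequality for every element of the second-order superjet, with
  the Levy increment of \<open>u\<close> itself, whose integrability is part of the conclusion.\<close>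

definition subsolution_J ::
  "(real^'n) set \<Rightarrow> (real^'n \<Rightarrow> real \<Rightarrow> real^'n \<Rightarrow> real^'n^'n \<Rightarrow> real) \<Rightarrow> (real^'n) measure \<Rightarrow>
   (real^'n \<Rightarrow> real) \<Rightarrow> bool" where
  "subsolution_J \<Omega> F q u \<longleftrightarrow> usc u \<and>
     (\<forall>x\<in>\<Omega>. \<forall>(p, X)\<in>J2_plus u x. integrable q (levy_increment u x p) \<and>
        F x (u x) p X \<le> (LINT z|q. levy_increment u x p z))"

lemma small_part_integrable:
  fixes X :: "real^'n^'n"
  assumes q: "levy_measure q" and \<epsilon>: "\<epsilon> \<le> 1"
  shows "integrable q (\<lambda>z. indicator {z. norm z < \<epsilon>} z * (1/2 * quad X z))"
proof -
  have sq: "sets q = sets borel" using q by (simp add: levy_measure_def)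
  obtain C where C: "0 \<le> C" "\<And>z. \<bar>quad X z\<bar> \<le> C * (norm z)\<^sup>2" using quad_bound[of X] by blast
  have mq: "quad X \<in> borel_measurable borel"
    by (intro borel_measurable_continuous_onI continuous_on_quad)
  show ?thesis
  proof (rule Bochner_Integration.integrable_bound[OF integrable_mult_right[OF levy_integrable_square[OF q], of C]])
    show "(\<lambda>z. indicator {z. norm z < \<epsilon>} z * (1/2 * quad X z)) \<in> borel_measurable q"
      unfolding measurable_cong_sets[OF sq refl] using mq by measurable
    show "AE z in q. norm (indicator {z. norm z < \<epsilon>} z * (1/2 * quad X z))
        \<le> norm (C * (indicator {z. norm z < 1} z * (norm z)\<^sup>2))"
    proof (rule AE_I2)
      fix z
      show "norm (indicator {z. norm z < \<epsilon>} z * (1/2 * quad X z))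
        \<le> norm (C * (indicator {z. norm z < 1} z * (norm z)\<^sup>2))"
        using C(1) C(2)[of z] \<epsilon> by (auto simp: indicator_def abs_mult)
    qed
  qed
qed

lemma levy_increment_0: "levy_increment u x p 0 = 0"
  by (simp add: levy_increment_def)

text \<open>The value \<open>\<delta> = 1\<close> suffices: the integral of the quadratic function over the ball of radius \<open>\<epsilon>\<close>
  vanishes in the limit whatever its coefficient is.\<close>

lemma subsolution_A_imp_J:
  fixes u :: "real^'n \<Rightarrow> real"
  assumes q: "levy_measure q" and tail: "tail_above q \<Omega> u" and A: "subsolution_A \<Omega> F q u"
  shows "subsolution_J \<Omega> F q u"
  unfolding subsolution_J_def
proof (intro conjI ballI, goal_cases)
  case 1
  show ?case using A by (simp add: subsolution_A_def)
next
  case (2 x pX)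
  obtain p X where pX: "pX = (p, X)" by (cases pX)
  have x: "x \<in> \<Omega>" and J: "(p, X) \<in> J2_plus u x" using 2 pX by auto
  have sq: "sets q = sets borel" using q by (simp add: levy_measure_def)
  have u: "usc u" using A by (simp add: subsolution_A_def)
  have Ax: "ereal (F x (u x) p X)
        - ereal (LINT z:{z. norm z < \<epsilon>}|q. 1/2 * quad (X + (2 * \<delta>) *\<^sub>R mat 1) z)
        - ext_integral q (\<lambda>z. indicator {z. \<epsilon> \<le> norm z} z * levy_increment u x p z) \<le> 0"
    if "0 < \<epsilon>" "\<epsilon> \<le> 1" "0 < \<delta>" "upper_expansion u x p X \<epsilon> \<delta>" for \<epsilon> \<delta>
    using bspec[OF bspec[OF conjunct2[OF A[unfolded subsolution_A_def]] x] J] that by simp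
  have "\<forall>\<delta>>0. \<exists>\<epsilon>>0. upper_expansion u x p X \<epsilon> \<delta>"
    using J by (simp add: J2_plus_def)
  then obtain \<rho> where \<rho>: "0 < \<rho>" "upper_expansion u x p X \<rho> 1"
    using zero_less_one by blast
  define r where "r = min \<rho> 1"
  have r: "0 < r" "r \<le> 1" "upper_expansion u x p X r 1"
    using \<rho> upper_expansion_mono[OF \<rho>(2), of r 1] by (auto simp: r_def)
  obtain C where C: "0 \<le> C" "\<And>z. \<bar>quad X z\<bar> \<le> C * (norm z)\<^sup>2" using quad_bound[of X] by blast
  let ?G = "dominant (C + 1) r u x p"
  have G: "integrable q ?G"
    using tail x C(1) by (intro integrable_dominant q u r) (auto simp: tail_above_def)
  have G0: "0 \<le> ?G z" for z using C(1) by (intro dominant_nonneg) simp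
  have hG: "levy_increment u x p z \<le> ?G z" for z
    by (rule levy_increment_le_dominant[OF r(3,2) C(2,1)])
  have mh: "levy_increment u x p \<in> borel_measurable q"
    by (rule levy_increment_measurable[OF usc_borel_measurable[OF u] sq])
  define \<epsilon> where "\<epsilon> n = r / real (Suc n)" for n
  have \<epsilon>: "0 < \<epsilon> n" "\<epsilon> n \<le> r" for n
    using r(1) by (simp_all add: \<epsilon>_def divide_le_eq distrib_left)
  have \<epsilon>0: "\<epsilon> \<longlonglongrightarrow> 0"
    unfolding \<epsilon>_def[abs_def] using LIMSEQ_Suc[OF lim_const_over_n[of r]] by simp
  let ?Y = "X + (2 * 1) *\<^sub>R mat 1 :: real^'n^'n"
  define s where "s n z = indicator {z. norm z < \<epsilon> n} z * (1/2 * quad ?Y z)" for n z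
  define f where "f n z = indicator {z. \<epsilon> n \<le> norm z} z * levy_increment u x p z" for n z
  have main: "integrable q (f n) \<and> F x (u x) p X \<le> (LINT z|q. s n z) + (LINT z|q. f n z)" for n
  proof -
    have "{z. \<epsilon> n \<le> norm z} \<in> sets q" unfolding sq by measurable
    then have mf: "f n \<in> borel_measurable q"
      unfolding f_def[abs_def] using mh by measurable
    have "(\<integral>\<^sup>+z. ennreal (f n z) \<partial>q) \<le> (\<integral>\<^sup>+z. ennreal (?G z) \<partial>q)"
      using hG G0 by (intro nn_integral_mono ennreal_leI) (auto simp: f_def indicator_def)
    also have "\<dots> < \<infinity>"
      using nn_integral_eq_integral[OF G] G0 by simp
    finally have fin: "(\<integral>\<^sup>+z. ennreal (f n z) \<partial>q) < \<infinity>" .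
    have "upper_expansion u x p X (\<epsilon> n) 1"
      using upper_expansion_mono[OF r(3) \<epsilon>(2)] by simp
    then have le: "ereal (F x (u x) p X) - ereal (LINT z|q. s n z) - ext_integral q (f n) \<le> 0"
      using Ax[of "\<epsilon> n" 1] \<epsilon>[of n] r(2)
      by (simp add: s_def[abs_def] f_def[abs_def] set_lebesgue_integral_def)
    then have "ext_integral q (f n) \<noteq> - \<infinity>" by auto
    with mf fin have int: "integrable q (f n)" by (rule integrable_if_ext_integral_finite)
    with le show ?thesis by (simp add: ext_integral_eq_integral)
  qed
  have sint: "integrable q (s n)" for n
    unfolding s_def[abs_def] using order_trans[OF \<epsilon>(2) r(2)] by (rule small_part_integrable[OF q])
  have "integrable q (levy_increment u x p) \<and> F x (u x) p X \<le> (LINT z|q. levy_increment u x p z)"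
  proof (rule reverse_Fatou[OF mh _ G, of "\<lambda>n z. s n z + f n z" "\<lambda>_. F x (u x) p X"])
    show "integrable q (\<lambda>z. s n z + f n z)" for n
      using sint main by (intro Bochner_Integration.integrable_add) auto
    show "F x (u x) p X \<le> (LINT z|q. s n z + f n z)" for n
      using sint main[of n] by simp
    show "s n z + f n z \<le> ?G z" for n z
    proof (cases "norm z < \<epsilon> n")
      case True
      then have "norm z < r" using \<epsilon>(2)[of n] by linarith
      moreover have "0 \<le> C * (norm z)\<^sup>2" using C(1) by simp
      ultimately show ?thesis
        using True C(2)[of z] quad_add_scaled_identity[of X 2 z]
        by (simp add: s_def f_def dominant_def distrib_right)
    next
      case False
      then show ?thesis using hG by (simp add: s_def f_def)
    qed
    show "(\<lambda>n. s n z + f n z) \<longlonglongrightarrow> levy_increment u x p z" for z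
    proof (cases "z = 0")
      case True
      then show ?thesis by (simp add: s_def f_def levy_increment_0 quad_def)
    next
      case False
      then have "eventually (\<lambda>n. \<epsilon> n < norm z) sequentially"
        by (intro order_tendstoD(2)[OF \<epsilon>0]) simp
      then have "eventually (\<lambda>n. s n z + f n z = levy_increment u x p z) sequentially"
        by (rule eventually_mono) (simp add: s_def f_def)
      then show ?thesis by (rule tendsto_eventually)
    qed
  qed auto
  then show ?case by (simp add: pX)
qed

lemma subsolution_J_imp_A:
  fixes u :: "real^'n \<Rightarrow> real"
  assumes q: "levy_measure q" and J: "subsolution_J \<Omega> F q u"
  shows "subsolution_A \<Omega> F q u"
proof -
  have sq: "sets q = sets borel" using q by (simp add: levy_measure_def)
  have "ereal (F x (u x) p X)
        - ereal (LINT z:{z. norm z < \<epsilon>}|q. 1/2 * quad (X + (2 * \<delta>) *\<^sub>R mat 1) z)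
        - ext_integral q (\<lambda>z. indicator {z. \<epsilon> \<le> norm z} z * levy_increment u x p z) \<le> 0"
    if x: "x \<in> \<Omega>" and pX: "(p, X) \<in> J2_plus u x" and \<epsilon>: "\<epsilon> \<le> 1"
      and exp: "upper_expansion u x p X \<epsilon> \<delta>" for x p X \<epsilon> \<delta>
  proof -
    let ?h = "levy_increment u x p"
    let ?s = "\<lambda>z. indicator {z. norm z < \<epsilon>} z * (1/2 * quad (X + (2 * \<delta>) *\<^sub>R mat 1) z)"
    let ?f = "\<lambda>z. indicator {z. \<epsilon> \<le> norm z} z * ?h z"
    have h: "integrable q ?h" "F x (u x) p X \<le> (LINT z|q. ?h z)"
      using J x pX unfolding subsolution_J_def by auto
    have s: "integrable q ?s" by (rule small_part_integrable[OF q \<epsilon>])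
    have "{z. \<epsilon> \<le> norm z} \<in> sets q" unfolding sq by measurable
    then have f: "integrable q ?f"
      using integrable_mult_indicator[OF _ h(1)] by simp
    have "(LINT z|q. ?h z) \<le> (LINT z|q. ?s z + ?f z)"
    proof (rule integral_mono[OF h(1) Bochner_Integration.integrable_add[OF s f]])
      fix z
      show "?h z \<le> ?s z + ?f z"
      proof (cases "norm z < \<epsilon>")
        case True
        then have "u (x + z) - u x \<le> p \<bullet> z + 1/2 * quad X z + \<delta> * (norm z)\<^sup>2"
          using exp by (simp add: upper_expansion_def)
        then show ?thesis
          using True \<epsilon> by (simp add: levy_increment_def inner_commute quad_add_scaled_identity field_simps)
      qed simp
    qed
    also have "\<dots> = (LINT z|q. ?s z) + (LINT z|q. ?f z)"
      by (rule Bochner_Integration.integral_add[OF s f])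
    finally have "F x (u x) p X - (LINT z|q. ?s z) - (LINT z|q. ?f z) \<le> 0"
      using h(2) by linarith
    then show ?thesis
      by (simp add: ext_integral_eq_integral[OF f] set_lebesgue_integral_def)
  qed
  then show ?thesis
    using J unfolding subsolution_A_def subsolution_J_def by blast
qed

lemma touches_above_imp_superjet:
  assumes "C2 \<phi>" "touches_above \<phi> u x"
  shows "(grad \<phi> x, hess \<phi> x) \<in> J2_plus u x"
proof -
  have "\<exists>\<epsilon>>0. upper_expansion u x (grad \<phi> x) (hess \<phi> x) \<epsilon> \<delta>" if \<delta>: "0 < \<delta>" for \<delta>
  proof -
    obtain \<epsilon> where \<epsilon>: "0 < \<epsilon>" "\<And>z. norm z \<le> \<epsilon> \<Longrightarrow>
        \<bar>\<phi> (x + z) - \<phi> x - grad \<phi> x \<bullet> z - 1/2 * quad (hess \<phi> x) z\<bar> \<le> \<delta> * (norm z)\<^sup>2"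
      using taylor_expansion[OF assms(1) \<delta>, of x] by blast
    have "u (x + z) - \<phi> (x + z) \<le> u x - \<phi> x" for z
      using assms(2) unfolding touches_above_def by blast
    with \<epsilon> have "upper_expansion u x (grad \<phi> x) (hess \<phi> x) \<epsilon> \<delta>"
      unfolding upper_expansion_def by (smt (verit))
    with \<epsilon>(1) show ?thesis by blast
  qed
  then show ?thesis by (simp add: J2_plus_def hess_symmetric[OF assms(1)])
qed

lemma subsolution_J_imp_C: "subsolution_J \<Omega> F q u \<Longrightarrow> subsolution_C \<Omega> F q u"
  unfolding subsolution_J_def subsolution_C_def
  using touches_above_imp_superjet by fastforce

lemma subsolution_C_imp_B:
  assumes "subsolution_C \<Omega> F q u" shows "subsolution_B \<Omega> F q u"
proof -
  have "ereal (F x (u x) (grad \<phi> x) (hess \<phi> x)) - ext_integral q (levy_increment \<phi> x (grad \<phi> x)) \<le> 0"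
    if x: "x \<in> \<Omega>" and \<phi>: "C2 \<phi>" "touches_above \<phi> u x" for x \<phi>
  proof -
    have int: "integrable q (levy_increment u x (grad \<phi> x))"
      and le: "F x (u x) (grad \<phi> x) (hess \<phi> x) \<le> (LINT z|q. levy_increment u x (grad \<phi> x) z)"
      using assms x \<phi> unfolding subsolution_C_def by auto
    have "ereal (F x (u x) (grad \<phi> x) (hess \<phi> x)) \<le> ext_integral q (levy_increment u x (grad \<phi> x))"
      using le by (simp add: ext_integral_eq_integral[OF int])
    also have "\<dots> \<le> ext_integral q (levy_increment \<phi> x (grad \<phi> x))"
    proof (rule ext_integral_mono)
      fix z
      have "u x = \<phi> x" "u (x + z) - \<phi> (x + z) \<le> u x - \<phi> x"
        using \<phi>(2) unfolding touches_above_def by blast+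
      then show "levy_increment u x (grad \<phi> x) z \<le> levy_increment \<phi> x (grad \<phi> x) z"
        by (simp add: levy_increment_def)
    qed
    finally show ?thesis
      by (cases "ext_integral q (levy_increment \<phi> x (grad \<phi> x))") auto
  qed
  then show ?thesis
    using assms unfolding subsolution_B_def subsolution_C_def by blast
qed

text \<open>Given an element \<open>(p, X)\<close> of the superjet, there are test functions with gradient \<open>p\<close> and
  Hessian \<open>X + 2\<eta>I\<close>, where \<open>\<eta>\<close> tends to \<open>0\<close>, whose Levy increments converge to that of \<open>u\<close> up to
  functions with vanishing integral.\<close>

lemma subsolution_B_imp_J:
  fixes u :: "real^'n \<Rightarrow> real"
  assumes q: "levy_measure q" and tail: "tail_above q \<Omega> u" and B: "subsolution_B \<Omega> F q u"
    and F: "\<And>x r p. x \<in> \<Omega> \<Longrightarrow> continuous_on sym_matrices (F x r p)"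
  shows "subsolution_J \<Omega> F q u"
  unfolding subsolution_J_def
proof (intro conjI ballI, goal_cases)
  case 1
  show ?case using B by (simp add: subsolution_B_def)
next
  case (2 x pX)
  obtain p X where pX: "pX = (p, X)" by (cases pX)
  have x: "x \<in> \<Omega>" and J: "(p, X) \<in> J2_plus u x" using 2 pX by auto
  have sq: "sets q = sets borel" using q by (simp add: levy_measure_def)
  have u: "usc u" using B by (simp add: subsolution_B_def)
  have X: "X \<in> sym_matrices" using J by (simp add: J2_plus_def)
  have ex: "\<exists>\<epsilon>>0. upper_expansion u x p X \<epsilon> \<delta>" if "0 < \<delta>" for \<delta>
    using J that by (simp add: J2_plus_def)
  obtain \<rho>' where \<rho>': "0 < \<rho>'" "upper_expansion u x p X \<rho>' 1" using ex[of 1] by auto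
  define \<rho> where "\<rho> = min \<rho>' 1"
  have \<rho>: "0 < \<rho>" "\<rho> \<le> 1" "upper_expansion u x p X \<rho> 1"
    using \<rho>' upper_expansion_mono[OF \<rho>'(2), of \<rho> 1] by (auto simp: \<rho>_def)
  obtain C where C: "0 \<le> C" "\<And>z. \<bar>quad X z\<bar> \<le> C * (norm z)\<^sup>2" using quad_bound[of X] by blast
  define \<eta> where "\<eta> n = 1 / real (Suc n)" for n
  have \<eta>: "0 < \<eta> n" "\<eta> n \<le> 1" for n by (auto simp: \<eta>_def)
  have \<eta>0: "\<eta> \<longlonglongrightarrow> 0"
    unfolding \<eta>_def[abs_def] using LIMSEQ_Suc[OF lim_const_over_n[of 1]] by simp
  have "\<exists>r. 0 < r \<and> r \<le> \<rho> \<and> r \<le> \<eta> n \<and> upper_expansion u x p X r (\<eta> n)" for n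
  proof -
    obtain \<epsilon> where \<epsilon>: "0 < \<epsilon>" "upper_expansion u x p X \<epsilon> (\<eta> n)" using ex[OF \<eta>(1)] by blast
    have "upper_expansion u x p X (min \<epsilon> (min \<rho> (\<eta> n))) (\<eta> n)"
      by (rule upper_expansion_mono[OF \<epsilon>(2)]) auto
    then show ?thesis
      using \<epsilon>(1) \<rho>(1) \<eta>(1) by (intro exI[of _ "min \<epsilon> (min \<rho> (\<eta> n))"]) auto
  qed
  then obtain r where r: "\<And>n. 0 < r n" "\<And>n. r n \<le> \<rho>" "\<And>n. r n \<le> \<eta> n"
    "\<And>n. upper_expansion u x p X (r n) (\<eta> n)"
    by metis
  have r1: "r n \<le> 1" for n using r(2)[of n] \<rho>(2) by linarith
  \<comment> \<open>The terms added to \<open>n\<close> keep the truncated increment below \<open>dominant\<close> near the origin.\<close>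
  define M where "M n = real n + \<bar>u x\<bar> + norm p" for n
  have M: "\<bar>u x\<bar> + norm p \<le> M n" "0 \<le> M n" for n by (auto simp: M_def)
  let ?h = "levy_increment u x p"
  let ?c = "\<lambda>n z. cutoff (r n) 0 z :: real"
  let ?Q = "\<lambda>n z. 1/2 * quad X z + \<eta> n * (norm z)\<^sup>2"
  let ?m = "\<lambda>n z. max (u (x + z)) (- M n) - u x - indicator {z. norm z \<le> 1} z * (z \<bullet> p)"
  \<comment> \<open>The increment of the \<open>n\<close>-th test function without its excess \<open>E\<close>.\<close>
  define g where "g n z = ?c n z * ?Q n z + (1 - ?c n z) * ?m n z" for n z
  let ?G = "dominant (C + 1) \<rho> u x p"
  have G: "integrable q ?G"
    using tail x C(1) by (intro integrable_dominant q u \<rho>) (auto simp: tail_above_def)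
  have mh: "?h \<in> borel_measurable q"
    by (rule levy_increment_measurable[OF usc_borel_measurable[OF u] sq])
  have Q_bound: "\<bar>?Q n z\<bar> \<le> (C + 1) * (norm z)\<^sup>2" for n z
  proof -
    have "0 \<le> \<eta> n * (norm z)\<^sup>2" using \<eta>(1)[of n] by simp
    moreover have "\<eta> n * (norm z)\<^sup>2 \<le> 1 * (norm z)\<^sup>2"
      by (rule mult_right_mono[OF \<eta>(2)]) simp
    moreover have "0 \<le> C * (norm z)\<^sup>2" using C(1) by simp
    ultimately show ?thesis
      using C(2)[of z] by (simp add: distrib_right abs_le_iff)
  qed
  have c_supp: "norm z < r n" if "?c n z \<noteq> 0" for n z
    using cutoff_0_outer[OF r(1), of n z] that by (meson not_less)
  have conv: "c * a + (1 - c) * b \<le> d" if "0 \<le> c" "c \<le> 1" "a \<le> d" "b \<le> d" for a b c d :: real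
    using convex_bound_le[of a d b c "1 - c"] that by simp
  have m_lower: "- (M n + \<bar>u x\<bar> + norm p) \<le> ?m n z" for n z
    using first_order_bound[of z p] by linarith
  have g_le: "g n z \<le> ?G z" for n z
  proof (cases "norm z < \<rho>")
    case True
    have "u (x + z) - u x \<le> p \<bullet> z + 1/2 * quad X z + 1 * (norm z)\<^sup>2"
      using \<rho>(3) True by (simp add: upper_expansion_def)
    moreover have "0 \<le> C * (norm z)\<^sup>2" "0 \<le> (norm z)\<^sup>2" using C(1) by auto
    moreover have "\<bar>z \<bullet> p\<bar> \<le> norm p"
      using first_order_bound[of z p] True \<rho>(2) by simp
    moreover have "?m n z = max (u (x + z)) (- M n) - u x - z \<bullet> p"
      using True \<rho>(2) by simp
    moreover have "(C + 1) * (norm z)\<^sup>2 = C * (norm z)\<^sup>2 + (norm z)\<^sup>2"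
      by (simp add: distrib_right)
    ultimately have "?m n z \<le> (C + 1) * (norm z)\<^sup>2"
      using C(2)[of z] M(1)[of n] inner_commute[of p z] by linarith
    moreover have "?Q n z \<le> (C + 1) * (norm z)\<^sup>2"
      by (rule order_trans[OF abs_ge_self Q_bound])
    ultimately show ?thesis
      unfolding g_def using True cutoff_bounds by (auto simp: dominant_def intro!: conv)
  next
    case False
    then have "?c n z = 0" using c_supp[of n z] r(2)[of n] by force
    moreover have "?m n z \<le> max (u (x + z)) 0 + \<bar>u x\<bar> + norm p"
      using first_order_bound[of z p] M(2)[of n] by linarith
    ultimately show ?thesis using False by (simp add: g_def dominant_def)
  qed
  have mu: "(\<lambda>z. u (x + z)) \<in> borel_measurable q"
    by (rule borel_measurable_shift[OF usc_borel_measurable[OF u] sq])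
  have mg: "g n \<in> borel_measurable q" for n
  proof -
    have mc: "?c n \<in> borel_measurable q"
      unfolding measurable_cong_sets[OF sq refl]
      by (intro borel_measurable_continuous_onI continuous_on_cutoff)
    have mq: "?Q n \<in> borel_measurable q"
      unfolding measurable_cong_sets[OF sq refl]
      by (intro borel_measurable_continuous_onI continuous_intros continuous_on_quad)
    have mi: "(\<lambda>z. indicator {z. norm z \<le> 1} z * (z \<bullet> p)) \<in> borel_measurable q"
      unfolding measurable_cong_sets[OF sq refl] by measurable
    show ?thesis
      unfolding g_def[abs_def]
      by (intro borel_measurable_add borel_measurable_times borel_measurable_diff borel_measurable_max
          borel_measurable_const mc mq mi mu)
  qed
  have gint: "integrable q (g n)" for n
  proof -
    \<comment> \<open>The truncation of \<open>u\<close> at \<open>- M n\<close> bounds \<open>g n\<close> from below, which makes it integrable even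
      if the increment of \<open>u\<close> is not yet known to be.\<close>
    let ?L = "\<lambda>z. (C + 1) * (indicator {z. norm z < 1} z * (norm z)\<^sup>2)
      + indicator {z. r n / 2 \<le> norm z} z * (M n + \<bar>u x\<bar> + norm p)"
    have L: "integrable q (\<lambda>z. ?G z + ?L z)"
      using r(1)[of n] by (intro Bochner_Integration.integrable_add integrable_mult_right G
          levy_integrable_square q integrable_indicator_outside) auto
    have lower: "- ?L z \<le> g n z" for z
    proof -
      have "- ((C + 1) * (indicator {z. norm z < 1} z * (norm z)\<^sup>2)) \<le> ?c n z * ?Q n z"
      proof (cases "?c n z = 0")
        case False
        then have "norm z < 1" using c_supp[of n z] r1[of n] by linarith
        moreover have "\<bar>?c n z * ?Q n z\<bar> \<le> 1 * ((C + 1) * (norm z)\<^sup>2)"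
          unfolding abs_mult by (intro mult_mono Q_bound) (use cutoff_bounds[of "r n" 0 z] in auto)
        ultimately show ?thesis by (simp add: abs_le_iff)
      qed (use C(1) in simp)
      moreover have "- (indicator {z. r n / 2 \<le> norm z} z * (M n + \<bar>u x\<bar> + norm p)) \<le> (1 - ?c n z) * ?m n z"
      proof (cases "norm z < r n / 2")
        case True
        then show ?thesis using cutoff_0_inner[OF r(1), of z n] by simp
      next
        case False
        have K: "0 \<le> M n + \<bar>u x\<bar> + norm p" using M(2)[of n] by simp
        have c01: "0 \<le> 1 - ?c n z" "1 - ?c n z \<le> 1" using cutoff_bounds[of "r n" 0 z] by auto
        have "- (M n + \<bar>u x\<bar> + norm p) \<le> (1 - ?c n z) * (- (M n + \<bar>u x\<bar> + norm p))"
          using mult_right_mono[OF c01(2) K] by (simp only: mult_minus_right neg_le_iff_le mult_1_left)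
        also have "\<dots> \<le> (1 - ?c n z) * ?m n z" by (rule mult_left_mono[OF m_lower c01(1)])
        finally show ?thesis using False by simp
      qed
      ultimately show ?thesis unfolding g_def by linarith
    qed
    show ?thesis
    proof (rule Bochner_Integration.integrable_bound[OF L mg AE_I2])
      fix z
      have "0 \<le> ?G z" using C(1) by (intro dominant_nonneg) simp
      moreover have "0 \<le> ?L z" using C(1) M(2)[of n] by simp
      ultimately show "norm (g n z) \<le> norm (?G z + ?L z)"
        using lower[of z] g_le[of n z] by (simp only: real_norm_def)
    qed
  qed
  have F_le: "F x (u x) p (X + (2 * \<eta> n) *\<^sub>R mat 1) - \<eta> n \<le> (LINT z|q. g n z)" for n
  proof -
    obtain \<phi> E where \<phi>: "C2 \<phi>" "touches_above \<phi> u x" "grad \<phi> x = p"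
      "hess \<phi> x = X + (2 * \<eta> n) *\<^sub>R mat 1" and E: "integrable q E" "(LINT z|q. E z) \<le> \<eta> n"
      and \<phi>E: "\<And>z. \<phi> (x + z) = ?c n z * (u x + p \<bullet> z + 1/2 * quad X z + \<eta> n * (norm z)\<^sup>2)
         + (1 - ?c n z) * max (u (x + z)) (- M n) + E z"
      by (rule test_function[OF u X q r(1)[of n] r1 r(4)[of n] \<eta>(1)[of n], of "M n"]) (rule that)
    have \<phi>x: "\<phi> x = u x" using \<phi>(2) by (simp add: touches_above_def)
    have inc: "levy_increment \<phi> x p z = g n z + E z" for z
    proof (cases "?c n z = 0")
      case True
      then show ?thesis
        by (simp add: levy_increment_def \<phi>E \<phi>x g_def)
    next
      case False
      then have "norm z \<le> 1" using c_supp[of n z] r1[of n] by linarith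
      then show ?thesis
        by (simp add: levy_increment_def \<phi>E \<phi>x g_def inner_commute[of z p] algebra_simps)
    qed
    have int: "integrable q (levy_increment \<phi> x p)"
      unfolding inc[abs_def] by (intro Bochner_Integration.integrable_add gint E(1))
    have "F x (u x) p (X + (2 * \<eta> n) *\<^sub>R mat 1) \<le> (LINT z|q. levy_increment \<phi> x p z)"
    proof -
      have "ereal (F x (u x) (grad \<phi> x) (hess \<phi> x)) - ext_integral q (levy_increment \<phi> x (grad \<phi> x)) \<le> 0"
        using bspec[OF conjunct2[OF B[unfolded subsolution_B_def]] x, THEN spec, of \<phi>]
          \<phi>(1-3) integrable_imp_has_ext_integral[OF int] by simp
      then show ?thesis
        unfolding \<phi>(3,4) by (simp add: ext_integral_eq_integral[OF int])
    qed
    also have "\<dots> = (LINT z|q. g n z) + (LINT z|q. E z)"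
      unfolding inc by (rule Bochner_Integration.integral_add[OF gint E(1)])
    finally show ?thesis using E(2) by linarith
  qed
  have F_lim: "(\<lambda>n. F x (u x) p (X + (2 * \<eta> n) *\<^sub>R mat 1) - \<eta> n) \<longlonglongrightarrow> F x (u x) p X"
  proof -
    have "(\<lambda>n. X + (2 * \<eta> n) *\<^sub>R mat 1) \<longlonglongrightarrow> X + (2 * 0) *\<^sub>R mat 1"
      by (intro tendsto_intros \<eta>0)
    then have "(\<lambda>n. F x (u x) p (X + (2 * \<eta> n) *\<^sub>R mat 1)) \<longlonglongrightarrow> F x (u x) p X"
      by (intro continuous_on_tendsto_compose[OF F[OF x] _ X])
        (auto intro!: sym_matrices_add_scaled_identity X always_eventually)
    from tendsto_diff[OF this \<eta>0] show ?thesis by simp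
  qed
  have g_lim: "(\<lambda>n. g n z) \<longlonglongrightarrow> ?h z" for z
  proof (cases "z = 0")
    case True
    have "g n 0 = 0" for n
      using cutoff_0_inner[OF r(1), of "0 :: real^'n" n] r(1)[of n] by (simp add: g_def quad_def)
    then show ?thesis using True by (simp add: levy_increment_0)
  next
    case False
    obtain N :: nat where N: "\<bar>u (x + z)\<bar> \<le> real N" using real_arch_simple by blast
    have "eventually (\<lambda>n. \<eta> n < norm z) sequentially"
      using False by (intro order_tendstoD(2)[OF \<eta>0]) simp
    then have "eventually (\<lambda>n. g n z = ?h z) sequentially"
      using eventually_ge_at_top[of N]
    proof eventually_elim
      case (elim n)
      have "?c n z = 0" using c_supp[of n z] r(3)[of n] elim(1) by force
      moreover have "- M n \<le> u (x + z)"
        using N of_nat_mono[OF elim(2), where 'a = real] norm_ge_zero[of p] unfolding M_def by linarith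
      ultimately show ?case by (simp add: g_def levy_increment_def max_absorb1)
    qed
    then show ?thesis by (rule tendsto_eventually)
  qed
  have "integrable q ?h \<and> F x (u x) p X \<le> (LINT z|q. ?h z)"
    by (rule reverse_Fatou[OF mh gint G g_le g_lim F_le F_lim])
  then show ?case by (simp add: pX)
qed

lemma subsolution_equivalence:
  fixes u :: "real^'n \<Rightarrow> real"
  assumes "levy_measure q" "tail_above q \<Omega> u"
    and "\<And>x r p. x \<in> \<Omega> \<Longrightarrow> continuous_on sym_matrices (F x r p)"
  shows "subsolution_A \<Omega> F q u \<longleftrightarrow> subsolution_B \<Omega> F q u"
    and "subsolution_B \<Omega> F q u \<longleftrightarrow> subsolution_C \<Omega> F q u"
proof -
  have AJ: "subsolution_A \<Omega> F q u \<Longrightarrow> subsolution_J \<Omega> F q u"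
    by (rule subsolution_A_imp_J[OF assms(1,2)])
  have JA: "subsolution_J \<Omega> F q u \<Longrightarrow> subsolution_A \<Omega> F q u"
    by (rule subsolution_J_imp_A[OF assms(1)])
  have BJ: "subsolution_B \<Omega> F q u \<Longrightarrow> subsolution_J \<Omega> F q u"
    by (rule subsolution_B_imp_J[OF assms(1,2) _ assms(3)])
  have JC: "subsolution_J \<Omega> F q u \<Longrightarrow> subsolution_C \<Omega> F q u"
    by (rule subsolution_J_imp_C)
  have CB: "subsolution_C \<Omega> F q u \<Longrightarrow> subsolution_B \<Omega> F q u"
    by (rule subsolution_C_imp_B)
  show "subsolution_A \<Omega> F q u \<longleftrightarrow> subsolution_B \<Omega> F q u"
    using AJ JA BJ JC CB by argo
  show "subsolution_B \<Omega> F q u \<longleftrightarrow> subsolution_C \<Omega> F q u"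
    using BJ JC CB by argo
qed

section \<open>Supersolutions by duality\<close>

text \<open>A function \<open>v\<close> is a supersolution for \<open>F\<close> exactly if \<open>-v\<close> is a subsolution for the dual
  operator; for definition A this uses the condition on \<open>v\<close> at infinity.\<close>

definition dual_operator ::
  "(real^'n \<Rightarrow> real \<Rightarrow> real^'n \<Rightarrow> real^'n^'n \<Rightarrow> real) \<Rightarrow> real^'n \<Rightarrow> real \<Rightarrow> real^'n \<Rightarrow> real^'n^'n \<Rightarrow> real" where
  "dual_operator F x r p X = - F x (- r) (- p) (- X)"

lemma usc_uminus_iff: "usc (\<lambda>y. - v y) \<longleftrightarrow> lsc v"
proof
  assume "usc (\<lambda>y. - v y)"
  then have "open {y. - v y < - a}" for a unfolding usc_def by blast
  then show "lsc v" by (simp add: lsc_def)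
next
  assume "lsc v"
  then have "open {y. - a < v y}" for a unfolding lsc_def by blast
  then show "usc (\<lambda>y. - v y)" by (simp add: usc_def minus_less_iff)
qed

lemma matrix_vector_mult_uminus: "(- X) *v z = - (X *v z)"
  for X :: "real^'n^'m"
  by (simp add: matrix_vector_mult_def vec_eq_iff sum_negf)

lemma quad_uminus: "quad (- X) z = - quad X z"
  by (simp add: quad_def matrix_vector_mult_uminus)

lemma uminus_sym_matrices: "X \<in> sym_matrices \<Longrightarrow> - X \<in> sym_matrices"
  by (simp add: sym_matrices_def vec_eq_iff transpose_def)

lemma expansion_uminus:
  "upper_expansion (\<lambda>y. - v y) x (- p) (- X) \<epsilon> \<delta> \<longleftrightarrow> lower_expansion v x p X \<epsilon> \<delta>"
  unfolding upper_expansion_def lower_expansion_def quad_uminus inner_minus_left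
  by (intro all_cong) linarith

lemma jet_uminus: "(- p, - X) \<in> J2_plus (\<lambda>y. - v y) x \<longleftrightarrow> (p, X) \<in> J2_minus v x"
  using uminus_sym_matrices[of X] uminus_sym_matrices[of "- X"]
  by (auto simp: J2_plus_def J2_minus_def expansion_uminus)

lemma levy_increment_uminus:
  "levy_increment (\<lambda>y. - v y) x (- p) z = - levy_increment v x p z"
  by (simp add: levy_increment_def)

lemma C2_uminus:
  assumes "C2 \<phi>"
  shows "C2 (\<lambda>y. - \<phi> y)" "grad (\<lambda>y. - \<phi> y) x = - grad \<phi> x" "hess (\<lambda>y. - \<phi> y) x = - hess \<phi> x"
proof -
  have G: "GDERIV (\<lambda>y. - \<phi> y) x :> - grad \<phi> x" for x
    by (rule GDERIV_minus[OF C2_grad[OF assms]])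
  then have g: "grad (\<lambda>y. - \<phi> y) = (\<lambda>x. - grad \<phi> x)"
    by (simp add: grad_eq fun_eq_iff)
  have D: "(grad (\<lambda>y. - \<phi> y) has_derivative (*v) (- hess \<phi> x)) (at x)" for x
  proof -
    have "(\<lambda>h. - (hess \<phi> x *v h)) = (*v) (- hess \<phi> x)"
      by (simp add: matrix_vector_mult_uminus fun_eq_iff)
    then show ?thesis
      using has_derivative_minus[OF C2_hess[OF assms, of x]] unfolding g by simp
  qed
  have h: "hess (\<lambda>y. - \<phi> y) = (\<lambda>x. - hess \<phi> x)"
    by (simp add: hess_eq[OF D] matrix_of_matrix_vector_mul fun_eq_iff)
  show "grad (\<lambda>y. - \<phi> y) x = - grad \<phi> x" "hess (\<lambda>y. - \<phi> y) x = - hess \<phi> x"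
    by (simp_all add: g h)
  have "continuous_on UNIV (\<lambda>x. - hess \<phi> x)"
    using assms by (intro continuous_on_minus) (simp add: C2_def)
  then show "C2 (\<lambda>y. - \<phi> y)"
    unfolding C2_def h using G D unfolding gderiv_def differentiable_def by blast
qed

lemma C2_uminus_iff: "C2 (\<lambda>y. - \<phi> y) \<longleftrightarrow> C2 \<phi>"
  using C2_uminus(1)[of \<phi>] C2_uminus(1)[of "\<lambda>y. - \<phi> y"] by auto

lemma touches_uminus:
  "touches_above (\<lambda>y. - \<phi> y) (\<lambda>y. - v y) x \<longleftrightarrow> touches_below \<phi> v x"
  unfolding touches_above_def touches_below_def by (auto simp: algebra_simps)

lemma all_uminus_function: "(\<forall>\<phi> :: 'a \<Rightarrow> real. P \<phi>) \<longleftrightarrow> (\<forall>\<phi>. P (\<lambda>y. - \<phi> y))"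
proof (intro iffI allI)
  fix \<phi> :: "'a \<Rightarrow> real"
  assume "\<forall>\<phi>. P (\<lambda>y. - \<phi> y)"
  then have "P (\<lambda>y. - (- \<phi> y))" by (rule spec)
  then show "P \<phi>" by simp
qed simp

lemma ball_jet_uminus:
  "(\<forall>(p, X)\<in>J2_plus (\<lambda>y. - v y) x. P p X) \<longleftrightarrow> (\<forall>(p, X)\<in>J2_minus v x. P (- p) (- X))"
proof
  assume P: "\<forall>(p, X)\<in>J2_plus (\<lambda>y. - v y) x. P p X"
  show "\<forall>(p, X)\<in>J2_minus v x. P (- p) (- X)"
  proof clarify
    fix p X assume "(p, X) \<in> J2_minus v x"
    then have "(- p, - X) \<in> J2_plus (\<lambda>y. - v y) x" by (simp only: jet_uminus)
    from bspec[OF P this] show "P (- p) (- X)" by simp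
  qed
next
  assume P: "\<forall>(p, X)\<in>J2_minus v x. P (- p) (- X)"
  show "\<forall>(p, X)\<in>J2_plus (\<lambda>y. - v y) x. P p X"
  proof clarify
    fix p X assume "(p, X) \<in> J2_plus (\<lambda>y. - v y) x"
    then have "(- p, - X) \<in> J2_minus v x" using jet_uminus[of "- p" "- X" v x] by simp
    from bspec[OF P this] show "P p X" by simp
  qed
qed

lemma ball_jet_uminus_cong:
  assumes "\<And>p X. P (- p) (- X) \<longleftrightarrow> Q p X"
  shows "(\<forall>(p, X)\<in>J2_plus (\<lambda>y. - v y) x. P p X) \<longleftrightarrow> (\<forall>(p, X)\<in>J2_minus v x. Q p X)"
  unfolding ball_jet_uminus assms ..

lemma ereal_dual_inequality:
  "ereal (- a) - ereal (- c) - (- e) \<le> 0 \<longleftrightarrow> ereal a - ereal c - e \<ge> 0"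
  by (cases e) auto

lemma tail_uminus: "tail_above q \<Omega> (\<lambda>y. - v y) \<longleftrightarrow> tail_below q \<Omega> v"
  by (simp add: tail_above_def tail_below_def)

text \<open>The condition on \<open>v\<close> at infinity makes the negative part of the increment integrable away from
  the origin, so that its integral changes sign under duality.\<close>

lemma far_increment_has_ext_integral:
  fixes v :: "real^'n \<Rightarrow> real"
  assumes q: "levy_measure q" and v: "lsc v" and tail: "tail_below q \<Omega> v" and x: "x \<in> \<Omega>"
    and \<epsilon>: "0 < \<epsilon>" "\<epsilon> \<le> 1"
  shows "has_ext_integral q (\<lambda>z. indicator {z. \<epsilon> \<le> norm z} z * levy_increment v x p z)"
proof -
  let ?w = "\<lambda>y. - v y"
  have "integrable q (dominant 0 \<epsilon> ?w x (- p))"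
  proof (rule integrable_dominant[OF q _ \<epsilon>])
    show "usc ?w" using v by (simp only: usc_uminus_iff)
    show "(\<integral>\<^sup>+z\<in>{z. 1 \<le> norm z}. ennreal (?w (x + z)) \<partial>q) < \<infinity>"
      using tail x unfolding tail_below_def by blast
  qed simp
  then have fin: "(\<integral>\<^sup>+z. ennreal (dominant 0 \<epsilon> ?w x (- p) z) \<partial>q) < \<infinity>"
    unfolding real_integrable_def by (simp add: less_top)
  have "(\<integral>\<^sup>+z. ennreal (- (indicator {z. \<epsilon> \<le> norm z} z * levy_increment v x p z)) \<partial>q)
      \<le> (\<integral>\<^sup>+z. ennreal (dominant 0 \<epsilon> ?w x (- p) z) \<partial>q)"
  proof (rule nn_integral_mono, rule ennreal_leI)
    fix z
    show "- (indicator {z. \<epsilon> \<le> norm z} z * levy_increment v x p z) \<le> dominant 0 \<epsilon> ?w x (- p) z"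
    proof (cases "norm z < \<epsilon>")
      case True
      then show ?thesis by (simp add: dominant_def)
    next
      case False
      then show ?thesis
        using first_order_bound[of z p] by (simp add: dominant_def levy_increment_def)
    qed
  qed
  also note fin
  finally show ?thesis unfolding has_ext_integral_def by blast
qed

lemma supersolution_A_dual:
  fixes v :: "real^'n \<Rightarrow> real"
  assumes q: "levy_measure q" and tail: "tail_below q \<Omega> v"
  shows "supersolution_A \<Omega> F q v \<longleftrightarrow> subsolution_A \<Omega> (dual_operator F) q (\<lambda>y. - v y)"
proof (cases "lsc v")
  case True
  have key: "ereal (dual_operator F x (- v x) (- p) (- X))
        - ereal (LINT z:{z. norm z < \<epsilon>}|q. 1/2 * quad (- X + (2 * \<delta>) *\<^sub>R mat 1) z)
        - ext_integral q (\<lambda>z. indicator {z. \<epsilon> \<le> norm z} z * levy_increment (\<lambda>y. - v y) x (- p) z) \<le> 0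
      \<longleftrightarrow> ereal (F x (v x) p X)
        - ereal (LINT z:{z. norm z < \<epsilon>}|q. 1/2 * quad (X - (2 * \<delta>) *\<^sub>R mat 1) z)
        - ext_integral q (\<lambda>z. indicator {z. \<epsilon> \<le> norm z} z * levy_increment v x p z) \<ge> 0"
    if x: "x \<in> \<Omega>" and \<epsilon>: "0 < \<epsilon>" "\<epsilon> \<le> 1" for x p X \<epsilon> \<delta>
  proof -
    have "- X + (2 * \<delta>) *\<^sub>R mat 1 = - (X - (2 * \<delta>) *\<^sub>R mat 1)" by simp
    then have "quad (- X + (2 * \<delta>) *\<^sub>R mat 1) z = - quad (X - (2 * \<delta>) *\<^sub>R mat 1) z" for z
      by (simp only: quad_uminus)
    then have 1: "(LINT z:{z. norm z < \<epsilon>}|q. 1/2 * quad (- X + (2 * \<delta>) *\<^sub>R mat 1) z)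
        = - (LINT z:{z. norm z < \<epsilon>}|q. 1/2 * quad (X - (2 * \<delta>) *\<^sub>R mat 1) z)"
      by (simp add: set_lebesgue_integral_def)
    have 2: "ext_integral q (\<lambda>z. indicator {z. \<epsilon> \<le> norm z} z * levy_increment (\<lambda>y. - v y) x (- p) z)
        = - ext_integral q (\<lambda>z. indicator {z. \<epsilon> \<le> norm z} z * levy_increment v x p z)"
      using ext_integral_uminus[OF far_increment_has_ext_integral[OF q True tail x \<epsilon>]]
      by (simp add: levy_increment_uminus)
    have 3: "dual_operator F x (- v x) (- p) (- X) = - F x (v x) p X"
      by (simp add: dual_operator_def)
    show ?thesis unfolding 1 2 3 by (rule ereal_dual_inequality)
  qed
  show ?thesis
    unfolding supersolution_A_def subsolution_A_def usc_uminus_iff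
    by (intro conj_cong refl ball_cong ball_jet_uminus_cong[symmetric] all_cong1 imp_cong
        expansion_uminus key) auto
qed (simp add: supersolution_A_def subsolution_A_def usc_uminus_iff)

lemma has_ext_integral_uminus: "has_ext_integral M (\<lambda>z. - f z) \<longleftrightarrow> has_ext_integral M f"
  by (auto simp: has_ext_integral_def)

lemma supersolution_B_dual:
  "supersolution_B \<Omega> F q v \<longleftrightarrow> subsolution_B \<Omega> (dual_operator F) q (\<lambda>y. - v y)"
proof -
  have key: "(C2 (\<lambda>y. - \<phi> y) \<and> touches_above (\<lambda>y. - \<phi> y) (\<lambda>y. - v y) x \<and>
        has_ext_integral q (levy_increment (\<lambda>y. - \<phi> y) x (grad (\<lambda>y. - \<phi> y) x)) \<longrightarrow>
        ereal (dual_operator F x (- v x) (grad (\<lambda>y. - \<phi> y) x) (hess (\<lambda>y. - \<phi> y) x))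
        - ext_integral q (levy_increment (\<lambda>y. - \<phi> y) x (grad (\<lambda>y. - \<phi> y) x)) \<le> 0)
      \<longleftrightarrow> (C2 \<phi> \<and> touches_below \<phi> v x \<and>
        has_ext_integral q (levy_increment \<phi> x (grad \<phi> x)) \<longrightarrow>
        ereal (F x (v x) (grad \<phi> x) (hess \<phi> x))
        - ext_integral q (levy_increment \<phi> x (grad \<phi> x)) \<ge> 0)" for \<phi> x
  proof (cases "C2 \<phi>")
    case True
    have inc: "levy_increment (\<lambda>y. - \<phi> y) x (- grad \<phi> x) = (\<lambda>z. - levy_increment \<phi> x (grad \<phi> x) z)"
      by (simp add: levy_increment_uminus fun_eq_iff)
    have "ereal (- F x (v x) (grad \<phi> x) (hess \<phi> x)) - ext_integral q (\<lambda>z. - levy_increment \<phi> x (grad \<phi> x) z) \<le> 0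
      \<longleftrightarrow> ereal (F x (v x) (grad \<phi> x) (hess \<phi> x)) - ext_integral q (levy_increment \<phi> x (grad \<phi> x)) \<ge> 0"
      if "has_ext_integral q (levy_increment \<phi> x (grad \<phi> x))"
      using ereal_dual_inequality[of "F x (v x) (grad \<phi> x) (hess \<phi> x)" 0] ext_integral_uminus[OF that]
      by simp
    then show ?thesis
      unfolding C2_uminus_iff touches_uminus C2_uminus(2,3)[OF True] inc has_ext_integral_uminus
        dual_operator_def minus_minus
      by blast
  qed (simp add: C2_uminus_iff)
  show ?thesis
    unfolding supersolution_B_def subsolution_B_def usc_uminus_iff
    by (subst (2) all_uminus_function) (simp only: key)
qed

lemma supersolution_C_dual:
  "supersolution_C \<Omega> F q v \<longleftrightarrow> subsolution_C \<Omega> (dual_operator F) q (\<lambda>y. - v y)"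
proof -
  have key: "(C2 (\<lambda>y. - \<phi> y) \<and> touches_above (\<lambda>y. - \<phi> y) (\<lambda>y. - v y) x \<longrightarrow>
        integrable q (levy_increment (\<lambda>y. - v y) x (grad (\<lambda>y. - \<phi> y) x)) \<and>
        dual_operator F x (- v x) (grad (\<lambda>y. - \<phi> y) x) (hess (\<lambda>y. - \<phi> y) x)
        - (LINT z|q. levy_increment (\<lambda>y. - v y) x (grad (\<lambda>y. - \<phi> y) x) z) \<le> 0)
      \<longleftrightarrow> (C2 \<phi> \<and> touches_below \<phi> v x \<longrightarrow>
        integrable q (levy_increment v x (grad \<phi> x)) \<and>
        F x (v x) (grad \<phi> x) (hess \<phi> x) - (LINT z|q. levy_increment v x (grad \<phi> x) z) \<ge> 0)" for \<phi> x
  proof (cases "C2 \<phi>")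
    case True
    have inc: "levy_increment (\<lambda>y. - v y) x (- grad \<phi> x) = (\<lambda>z. - levy_increment v x (grad \<phi> x) z)"
      by (simp add: levy_increment_uminus fun_eq_iff)
    show ?thesis
      unfolding C2_uminus_iff touches_uminus C2_uminus(2,3)[OF True] inc dual_operator_def
      by simp
  qed (simp add: C2_uminus_iff)
  show ?thesis
    unfolding supersolution_C_def subsolution_C_def usc_uminus_iff
    by (subst (2) all_uminus_function) (simp only: key)
qed

lemma continuous_operator_in_matrix:
  assumes "continuous_operator \<Omega> F" "x \<in> \<Omega>"
  shows "continuous_on sym_matrices (F x r p)"
proof -
  have "continuous_on sym_matrices (\<lambda>X. (\<lambda>(x, r, p, X). F x r p X) (x, r, p, X))"
    by (rule continuous_on_compose2[OF assms(1)[unfolded continuous_operator_def]])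
      (use assms(2) in \<open>auto intro!: continuous_intros\<close>)
  then show ?thesis by simp
qed

lemma dual_operator_continuous:
  assumes "continuous_operator \<Omega> F" "x \<in> \<Omega>"
  shows "continuous_on sym_matrices (dual_operator F x r p)"
  unfolding dual_operator_def[abs_def]
  by (intro continuous_on_minus continuous_on_compose2[OF continuous_operator_in_matrix[OF assms]]
      continuous_on_id) (use uminus_sym_matrices in auto)

lemma supersolution_equivalence:
  fixes v :: "real^'n \<Rightarrow> real"
  assumes "levy_measure q" "tail_below q \<Omega> v" "continuous_operator \<Omega> F"
  shows "supersolution_A \<Omega> F q v \<longleftrightarrow> supersolution_B \<Omega> F q v"
    and "supersolution_B \<Omega> F q v \<longleftrightarrow> supersolution_C \<Omega> F q v"
proof -
  have tail: "tail_above q \<Omega> (\<lambda>y. - v y)" using assms(2) by (simp only: tail_uminus)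
  note eq = subsolution_equivalence[OF assms(1) tail, of "dual_operator F", OF dual_operator_continuous[OF assms(3)]]
  show "supersolution_A \<Omega> F q v \<longleftrightarrow> supersolution_B \<Omega> F q v"
    unfolding supersolution_A_dual[OF assms(1,2)] supersolution_B_dual by (rule eq(1))
  show "supersolution_B \<Omega> F q v \<longleftrightarrow> supersolution_C \<Omega> F q v"
    unfolding supersolution_B_dual supersolution_C_dual by (rule eq(2))
qed

theorem theorem3:
  fixes \<Omega> :: "(real^'n) set"
    and F :: "real^'n \<Rightarrow> real \<Rightarrow> real^'n \<Rightarrow> real^'n^'n \<Rightarrow> real"
    and q :: "(real^'n) measure"
  assumes "continuous_operator \<Omega> F"
    and "elliptic \<Omega> F"
    and "levy_measure q"
  shows "(\<forall>u. tail_above q \<Omega> u \<longrightarrow>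
            (subsolution_A \<Omega> F q u \<longleftrightarrow> subsolution_B \<Omega> F q u) \<and>
            (subsolution_B \<Omega> F q u \<longleftrightarrow> subsolution_C \<Omega> F q u)) \<and>
         (\<forall>v. tail_below q \<Omega> v \<longrightarrow>
            (supersolution_A \<Omega> F q v \<longleftrightarrow> supersolution_B \<Omega> F q v) \<and>
            (supersolution_B \<Omega> F q v \<longleftrightarrow> supersolution_C \<Omega> F q v)) \<and>
         (\<forall>u. tail_above q \<Omega> u \<and> tail_below q \<Omega> u \<longrightarrow>
            (solution_A \<Omega> F q u \<longleftrightarrow> solution_B \<Omega> F q u) \<and>
            (solution_B \<Omega> F q u \<longleftrightarrow> solution_C \<Omega> F q u))"
proof -
  have sub: "subsolution_A \<Omega> F q u \<longleftrightarrow> subsolution_B \<Omega> F q u"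
    "subsolution_B \<Omega> F q u \<longleftrightarrow> subsolution_C \<Omega> F q u" if "tail_above q \<Omega> u" for u
    using subsolution_equivalence[OF assms(3) that continuous_operator_in_matrix[OF assms(1)]]
    by auto
  have super: "supersolution_A \<Omega> F q v \<longleftrightarrow> supersolution_B \<Omega> F q v"
    "supersolution_B \<Omega> F q v \<longleftrightarrow> supersolution_C \<Omega> F q v" if "tail_below q \<Omega> v" for v
    by (rule supersolution_equivalence[OF assms(3) that assms(1)])+
  show ?thesis
    using sub super by (simp add: solution_A_def solution_B_def solution_C_def)
qed

end
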